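(* Let $L$ be a $5$-dimensional connected real Lie group with Lie algebra $\mathfrak l$, endowed with a left-invariant nearly integrable $\mathrm{SO}(3)$ structure $(g,\mathbb T)$, with adapted frame $e_1,\dots,e_5$, characteristic connection $\tilde\nabla$ and torsion three-form $T$. Put $\mathfrak h=\mathrm{span}\{e_1,e_2,e_4\}$ and $\mathfrak p=\mathrm{span}\{e_3,e_5\}$, and suppose that $$\tilde\nabla_X\mathfrak h\subseteq\mathfrak h,\quad \tilde\nabla_X\mathfrak p\subseteq\mathfrak p\quad\forall X\in\mathfrak h;\qquad \tilde\nabla_Y\mathfrak h\subseteq\mathfrak p,\quad \tilde\nabla_Y\mathfrak p\subseteq\mathfrak h\quad\forall Y\in\mathfrak p.$$ If $(\mathfrak l,\mathfrak h)$ is not a symmetric pair, then $\tilde\nabla=0$ and $T$ is harmonic: $dT=0$ and $d{*}T=0$. In addition, the commutator $\mathfrak l^1=[\mathfrak l,\mathfrak l]$ is $3$-dimensional and $\mathfrak l^1=\mathfrak l^2$, where $\mathfrak l^2=[\mathfrak l^1,\mathfrak l^1]$.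
   Context: A left-invariant $\mathrm{SO}(3)$ structure on a $5$-dimensional Lie group $L$ is given by a basis $e_1,\dots,e_5$ of the Lie algebra $\mathfrak l$ (the adapted frame, viewed as left-invariant vector fields, with dual coframe $e^1,\dots,e^5$): $g=\sum_i (e^i)^2$, and $\mathbb T$ is the left-invariant totally symmetric covariant $3$-tensor with, for $X=\sum x_ie_i$, $$\mathbb T(X,X,X)=x_1\bigl(3x_2^2+3x_4^2-x_1^2-\tfrac32x_3^2-\tfrac32x_5^2\bigr)+\tfrac{3\sqrt3}{2}x_4(x_5^2-x_3^2)+3\sqrt3\,x_2x_3x_5 .$$ With $\nabla$ the Levi-Civita connection of $g$, the structure is nearly integrable if $(\nabla_X\mathbb T)(X,X,X)=0$ for all $X$. In that case there is a unique connection $\tilde\nabla$, called the characteristic connection, with $\tilde\nabla g=0$, $\tilde\nabla\mathbb T=0$ and totally skew-symmetric torsion; its torsion three-form is $T(X,Y,Z)=g(\tilde\nabla_XY-\tilde\nabla_YX-[X,Y],Z)$. The notation $\tilde\nabla=0$ means $\tilde\nabla_{e_i}e_j=0$ for all $i,j$. The pair $(\mathfrak l,\mathfrak h)$, with $\mathfrak l=\mathfrak h\oplus\mathfrak p$, is a symmetric pair if $[\mathfrak h,\mathfrak h]\subseteq\mathfrak h$, $[\mathfrak h,\mathfrak p]\subseteq\mathfrak p$, $[\mathfrak p,\mathfrak p]\subseteq\mathfrak h$. $*$ is the Hodge star of $g$. *)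

theory Defs
  imports "HOL-Analysis.Analysis"
begin

text \<open>
  The libraries contain no Lie groups.  A Lie group \<open>L\<close> enters only through its Lie algebra, a real
  vector space \<open>'a\<close> with bracket \<open>br\<close>, and a left-invariant tensor field, form or connection on
  \<open>L\<close> is given by its values on left-invariant vector fields: a multilinear map on \<open>'a\<close>.
  Such values are constant functions on \<open>L\<close>, so in every invariant formula (Koszul formula,
  covariant derivative, exterior derivative) the terms differentiating a function vanish.
\<close>

definition lie_algebra :: "('a::real_vector \<Rightarrow> 'a \<Rightarrow> 'a) \<Rightarrow> bool" where
  "lie_algebra br \<longleftrightarrow> bilinear br \<and> (\<forall>x. br x x = 0) \<and>
     (\<forall>x y z. br x (br y z) + br y (br z x) + br z (br x y) = 0)"

definition bracket_span :: "('a::real_vector \<Rightarrow> 'a \<Rightarrow> 'a) \<Rightarrow> 'a set \<Rightarrow> 'a set \<Rightarrow> 'a set" where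
  "bracket_span br A B = span {br x y | x y. x \<in> A \<and> y \<in> B}"

definition symmetric_pair :: "('a::real_vector \<Rightarrow> 'a \<Rightarrow> 'a) \<Rightarrow> 'a set \<Rightarrow> 'a set \<Rightarrow> bool" where
  "symmetric_pair br h p \<longleftrightarrow>
     (\<forall>x\<in>h. \<forall>y\<in>h. br x y \<in> h) \<and>
     (\<forall>x\<in>h. \<forall>y\<in>p. br x y \<in> p) \<and>
     (\<forall>x\<in>p. \<forall>y\<in>p. br x y \<in> h)"


subsection \<open>The SO(3) structure of a frame\<close>

text \<open>Only the values \<open>e 1, \<dots>, e 5\<close> of \<open>e\<close> matter.\<close>

definition frame :: "(nat \<Rightarrow> 'a::real_vector) \<Rightarrow> bool" where
  "frame e \<longleftrightarrow> inj_on e {1..5} \<and> independent (e ` {1..5}) \<and> span (e ` {1..5}) = UNIV"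

definition coframe :: "(nat \<Rightarrow> 'a::real_vector) \<Rightarrow> nat \<Rightarrow> 'a \<Rightarrow> real" where
  "coframe e i x = representation (e ` {1..5}) x (e i)"

definition frame_metric :: "(nat \<Rightarrow> 'a::real_vector) \<Rightarrow> 'a \<Rightarrow> 'a \<Rightarrow> real" where
  "frame_metric e x y = (\<Sum>i=1..5. coframe e i x * coframe e i y)"

definition so3_cubic :: "(nat \<Rightarrow> 'a::real_vector) \<Rightarrow> 'a \<Rightarrow> real" where
  "so3_cubic e x = (let x1 = coframe e 1 x; x2 = coframe e 2 x; x3 = coframe e 3 x;
                        x4 = coframe e 4 x; x5 = coframe e 5 x in
     x1 * (3 * x2^2 + 3 * x4^2 - x1^2 - 3/2 * x3^2 - 3/2 * x5^2)
     + 3 * sqrt 3 / 2 * x4 * (x5^2 - x3^2) + 3 * sqrt 3 * x2 * x3 * x5)"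

text \<open>
  The symmetric trilinear form whose diagonal is the cubic, by polarization; the defining
  properties are \<open>so3_tensor_diag\<close>, \<open>so3_tensor_sym\<close> and \<open>so3_tensor_linear\<close> below.
\<close>

definition so3_tensor :: "(nat \<Rightarrow> 'a::real_vector) \<Rightarrow> 'a \<Rightarrow> 'a \<Rightarrow> 'a \<Rightarrow> real" where
  "so3_tensor e x y z =
     (so3_cubic e (x + y + z) - so3_cubic e (x + y) - so3_cubic e (x + z) - so3_cubic e (y + z)
      + so3_cubic e x + so3_cubic e y + so3_cubic e z) / 6"


subsection \<open>Left-invariant connections\<close>

text \<open>A left-invariant connection is a bilinear map \<open>D\<close>, with \<open>D x y\<close> the covariant derivative of
  \<open>y\<close> along \<open>x\<close>.\<close>

definition cov2 :: "('a \<Rightarrow> 'a \<Rightarrow> 'a) \<Rightarrow> ('a \<Rightarrow> 'a \<Rightarrow> real) \<Rightarrow> 'a \<Rightarrow> 'a \<Rightarrow> 'a \<Rightarrow> real" where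
  "cov2 D s x y z = - s (D x y) z - s y (D x z)"

definition cov3 :: "('a \<Rightarrow> 'a \<Rightarrow> 'a) \<Rightarrow> ('a \<Rightarrow> 'a \<Rightarrow> 'a \<Rightarrow> real) \<Rightarrow> 'a \<Rightarrow> 'a \<Rightarrow> 'a \<Rightarrow> 'a \<Rightarrow> real" where
  "cov3 D t x y z w = - t (D x y) z w - t y (D x z) w - t y z (D x w)"

definition is_levi_civita ::
  "('a::real_vector \<Rightarrow> 'a \<Rightarrow> 'a) \<Rightarrow> (nat \<Rightarrow> 'a) \<Rightarrow> ('a \<Rightarrow> 'a \<Rightarrow> 'a) \<Rightarrow> bool" where
  "is_levi_civita br e D \<longleftrightarrow> bilinear D \<and>
     (\<forall>x y z. cov2 D (frame_metric e) x y z = 0) \<and> (\<forall>x y. D x y - D y x = br x y)"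

definition levi_civita ::
  "('a::real_vector \<Rightarrow> 'a \<Rightarrow> 'a) \<Rightarrow> (nat \<Rightarrow> 'a) \<Rightarrow> 'a \<Rightarrow> 'a \<Rightarrow> 'a" where
  "levi_civita br e = (THE D. is_levi_civita br e D)"

definition nearly_integrable ::
  "('a::real_vector \<Rightarrow> 'a \<Rightarrow> 'a) \<Rightarrow> (nat \<Rightarrow> 'a) \<Rightarrow> bool" where
  "nearly_integrable br e \<longleftrightarrow> (\<forall>x. cov3 (levi_civita br e) (so3_tensor e) x x x x = 0)"

definition torsion_form ::
  "('a::real_vector \<Rightarrow> 'a \<Rightarrow> 'a) \<Rightarrow> (nat \<Rightarrow> 'a) \<Rightarrow> ('a \<Rightarrow> 'a \<Rightarrow> 'a) \<Rightarrow> 'a \<Rightarrow> 'a \<Rightarrow> 'a \<Rightarrow> real" where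
  "torsion_form br e D x y z = frame_metric e (D x y - D y x - br x y) z"

definition totally_skew :: "('a \<Rightarrow> 'a \<Rightarrow> 'a \<Rightarrow> real) \<Rightarrow> bool" where
  "totally_skew t \<longleftrightarrow> (\<forall>x y z. t y x z = - t x y z \<and> t x z y = - t x y z)"

definition characteristic_connection ::
  "('a::real_vector \<Rightarrow> 'a \<Rightarrow> 'a) \<Rightarrow> (nat \<Rightarrow> 'a) \<Rightarrow> ('a \<Rightarrow> 'a \<Rightarrow> 'a) \<Rightarrow> bool" where
  "characteristic_connection br e D \<longleftrightarrow> bilinear D \<and>
     (\<forall>x y z. cov2 D (frame_metric e) x y z = 0) \<and>
     (\<forall>x y z w. cov3 D (so3_tensor e) x y z w = 0) \<and>
     totally_skew (torsion_form br e D)"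


subsection \<open>Left-invariant differential forms\<close>

text \<open>A \<open>k\<close>-form is evaluated on the lists of length \<open>k\<close>; its values on other lists are irrelevant.\<close>

definition form3 :: "('a \<Rightarrow> 'a \<Rightarrow> 'a \<Rightarrow> real) \<Rightarrow> 'a list \<Rightarrow> real" where
  "form3 t xs = t (xs ! 0) (xs ! 1) (xs ! 2)"

text \<open>\<open>(d w)(x\<^sub>0, \<dots>, x\<^sub>k)\<close> is the sum over \<open>i < j\<close> of
  \<open>(-1)^(i+j) w([x\<^sub>i, x\<^sub>j], x\<^sub>0, \<dots>, x\<^sub>k)\<close> with \<open>x\<^sub>i\<close> and \<open>x\<^sub>j\<close> omitted after the bracket.\<close>

definition ext_deriv :: "('a \<Rightarrow> 'a \<Rightarrow> 'a) \<Rightarrow> ('a list \<Rightarrow> real) \<Rightarrow> 'a list \<Rightarrow> real" where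
  "ext_deriv br w xs = (\<Sum>j<length xs. \<Sum>i<j.
     (- 1) ^ (i + j) * w (br (xs ! i) (xs ! j) # nths xs (- {i, j})))"

text \<open>The volume form \<open>e\<^sup>1 \<and> \<dots> \<and> e\<^sup>5\<close>: the determinant of the matrix \<open>e\<^sup>i(x\<^sub>j)\<close>.\<close>

definition vol :: "(nat \<Rightarrow> 'a::real_vector) \<Rightarrow> 'a list \<Rightarrow> real" where
  "vol e xs = (\<Sum>p | p permutes {1..5}. of_int (sign p) * (\<Prod>i=1..5. coframe e (p i) (xs ! (i - 1))))"

text \<open>Hodge star on \<open>k\<close>-forms, normalised by \<open>e\<^sup>I \<and> *e\<^sup>I = vol\<close> for every increasing
  multi-index \<open>I\<close> of length \<open>k\<close>.\<close>

definition hodge :: "(nat \<Rightarrow> 'a::real_vector) \<Rightarrow> nat \<Rightarrow> ('a list \<Rightarrow> real) \<Rightarrow> 'a list \<Rightarrow> real" where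
  "hodge e k w ys = (\<Sum>I | I \<subseteq> {1..5} \<and> card I = k.
     let eI = map e (sorted_list_of_set I) in w eI * vol e (eI @ ys))"

definition closed_form :: "('a \<Rightarrow> 'a \<Rightarrow> 'a) \<Rightarrow> nat \<Rightarrow> ('a list \<Rightarrow> real) \<Rightarrow> bool" where
  "closed_form br k w \<longleftrightarrow> (\<forall>xs. length xs = k + 1 \<longrightarrow> ext_deriv br w xs = 0)"

definition harmonic_form ::
  "('a::real_vector \<Rightarrow> 'a \<Rightarrow> 'a) \<Rightarrow> (nat \<Rightarrow> 'a) \<Rightarrow> nat \<Rightarrow> ('a list \<Rightarrow> real) \<Rightarrow> bool" where
  "harmonic_form br e k w \<longleftrightarrow> closed_form br k w \<and> closed_form br (5 - k) (hodge e k w)"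


subsection \<open>The definitions have the intended properties\<close>

lemma coframe_linear:
  assumes "frame e"
  shows "linear (coframe e i)"
  using assms
  by (intro linearI) (auto simp: coframe_def frame_def real_vector.representation_add
      real_vector.representation_scale)

lemma coframe_basis:
  assumes "frame e" "i \<in> {1..5}" "j \<in> {1..5}"
  shows "coframe e i (e j) = (if i = j then 1 else 0)"
proof -
  have "representation (e ` {1..5}) (e j) = (\<lambda>v. if v = e j then 1 else 0)"
    using assms by (intro real_vector.representation_basis) (auto simp: frame_def)
  then show ?thesis
    using assms inj_on_eq_iff[of e "{1..5}" i j] by (auto simp: coframe_def frame_def)
qed

lemma frame_expansion:
  assumes "frame e"
  shows "(\<Sum>i=1..5. coframe e i x *\<^sub>R e i) = x"
proof -
  have "(\<Sum>b\<in>e ` {1..5}. representation (e ` {1..5}) x b *\<^sub>R b) = x"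
    using assms by (intro real_vector.sum_representation_eq) (auto simp: frame_def)
  moreover have "inj_on e {1..5}" using assms by (simp add: frame_def)
  ultimately show ?thesis by (simp add: sum.reindex coframe_def)
qed

lemma frame_metric_basis:
  assumes "frame e" "i \<in> {1..5}"
  shows "frame_metric e x (e i) = coframe e i x"
proof -
  have "frame_metric e x (e i) = (\<Sum>j=1..5. if j = i then coframe e j x else 0)"
    unfolding frame_metric_def using assms by (intro sum.cong) (auto simp: coframe_basis)
  also have "\<dots> = coframe e i x" using assms(2) by (subst sum.delta) auto
  finally show ?thesis .
qed

lemma frame_metric_sym: "frame_metric e x y = frame_metric e y x"
  by (simp add: frame_metric_def mult.commute)

lemma frame_metric_bilinear: "frame e \<Longrightarrow> bilinear (frame_metric e)"
  unfolding bilinear_def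
  by (intro conjI allI linearI)
    (simp_all add: frame_metric_def coframe_linear[THEN linear_add] coframe_linear[THEN linear_scale]
      algebra_simps sum.distrib sum_distrib_left)

lemma frame_metric_eqI:
  assumes "frame e" "\<And>z. frame_metric e x z = frame_metric e y z"
  shows "x = y"
proof -
  have "(\<Sum>i=1..5. coframe e i x *\<^sub>R e i) = (\<Sum>i=1..5. coframe e i y *\<^sub>R e i)"
    using assms(2) by (intro sum.cong refl) (metis frame_metric_basis[OF assms(1)])
  then show ?thesis by (simp only: frame_expansion[OF assms(1)])
qed

lemma so3_tensor_diag:
  assumes "frame e"
  shows "so3_tensor e x x x = so3_cubic e x"
  by (simp add: so3_tensor_def so3_cubic_def Let_def coframe_linear[OF assms, THEN linear_add]
      power2_eq_square field_simps)

lemma so3_tensor_sym: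
  "so3_tensor e x y z = so3_tensor e y x z" "so3_tensor e x y z = so3_tensor e x z y"
  by (simp_all add: so3_tensor_def add_ac)

lemma so3_tensor_explicit:
  assumes "frame e"
  defines "m \<equiv> (\<lambda>i j k x y z. (coframe e i x * coframe e j y * coframe e k z
      + coframe e i x * coframe e j z * coframe e k y + coframe e i y * coframe e j x * coframe e k z
      + coframe e i y * coframe e j z * coframe e k x + coframe e i z * coframe e j x * coframe e k y
      + coframe e i z * coframe e j y * coframe e k x) / 6)"
  shows "so3_tensor e x y z = 3 * m 1 2 2 x y z + 3 * m 1 4 4 x y z - m 1 1 1 x y z
    - 3/2 * m 1 3 3 x y z - 3/2 * m 1 5 5 x y z
    + 3 * sqrt 3 / 2 * (m 4 5 5 x y z - m 4 3 3 x y z) + 3 * sqrt 3 * m 2 3 5 x y z"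
proof -
  define c where "c i j k x = coframe e i x * coframe e j x * coframe e k x" for i j k x
  define P where "P f = (f (x + y + z) - f (x + y) - f (x + z) - f (y + z) + f x + f y + f z) / 6"
    for f :: "'a \<Rightarrow> real"
  have m: "P (c i j k) = m i j k x y z" for i j k
    by (simp add: P_def c_def m_def coframe_linear[OF assms(1), THEN linear_add] algebra_simps)
  have cubic: "so3_cubic e u = 3 * c 1 2 2 u + 3 * c 1 4 4 u - c 1 1 1 u - 3/2 * c 1 3 3 u
      - 3/2 * c 1 5 5 u + 3 * sqrt 3 / 2 * (c 4 5 5 u - c 4 3 3 u) + 3 * sqrt 3 * c 2 3 5 u" for u
  proof -
    have "x1 * (3 * x2^2 + 3 * x4^2 - x1^2 - 3/2 * x3^2 - 3/2 * x5^2) + 3 * r / 2 * x4 * (x5^2 - x3^2)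
        + 3 * r * x2 * x3 * x5 = 3 * (x1 * x2 * x2) + 3 * (x1 * x4 * x4) - x1 * x1 * x1
        - 3/2 * (x1 * x3 * x3) - 3/2 * (x1 * x5 * x5) + 3 * r / 2 * (x4 * x5 * x5 - x4 * x3 * x3)
        + 3 * r * (x2 * x3 * x5)" for x1 x2 x3 x4 x5 r :: real
      by (simp add: power2_eq_square field_simps)
    then show ?thesis unfolding so3_cubic_def Let_def c_def .
  qed
  have P_linear: "P (\<lambda>u. f u + g u) = P f + P g" "P (\<lambda>u. f u - g u) = P f - P g"
    "P (\<lambda>u. k * f u) = k * P f" for f g :: "'a \<Rightarrow> real" and k
    unfolding P_def by (simp_all add: field_simps)
  have "so3_tensor e x y z = P (\<lambda>u. so3_cubic e u)"
    by (simp only: so3_tensor_def P_def)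
  then show ?thesis by (simp only: cubic P_linear m)
qed

lemma so3_tensor_linear:
  assumes "frame e"
  shows "linear (\<lambda>x. so3_tensor e x y z)"
  by (intro linearI)
    (simp_all only: so3_tensor_explicit[OF assms] coframe_linear[OF assms, THEN linear_add]
      coframe_linear[OF assms, THEN linear_scale] real_scaleR_def, algebra+)

lemma ex1_levi_civita:
  assumes fr: "frame e" and br: "lie_algebra br"
  shows "\<exists>!D. is_levi_civita br e D"
proof -
  let ?g = "frame_metric e"
  have bg: "bilinear ?g" by (rule frame_metric_bilinear[OF fr])
  have bb: "bilinear br" using br by (simp add: lie_algebra_def)
  note gs = bilinear_ladd[OF bg] bilinear_radd[OF bg] bilinear_lsub[OF bg] bilinear_rsub[OF bg]
    bilinear_lmul[OF bg] bilinear_rmul[OF bg] bilinear_lneg[OF bg] bilinear_rneg[OF bg]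
  note bs = bilinear_ladd[OF bb] bilinear_radd[OF bb] bilinear_lmul[OF bb] bilinear_rmul[OF bb]
  have skew: "br y x = - br x y" for x y
  proof -
    have "br (x + y) (x + y) = 0" "br x x = 0" "br y y = 0"
      using br by (auto simp: lie_algebra_def)
    then have "br x y + br y x = 0" by (simp add: bs add.commute)
    then show ?thesis by (rule minus_unique[symmetric])
  qed
  define K where "K x y z = (?g (br x y) z - ?g (br y z) x + ?g (br z x) y) / 2" for x y z
  define D where "D x y = (\<Sum>i=1..5. K x y (e i) *\<^sub>R e i)" for x y
  have K_add: "K x y (u + v) = K x y u + K x y v" and K_scale: "K x y (c *\<^sub>R u) = c * K x y u"
    for x y u v c
    by (simp_all add: K_def gs bs field_simps)
  have K_lin: "linear (K x y)" for x y by (intro linearI) (simp_all add: K_add K_scale)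
  have gD: "?g (D x y) z = K x y z" for x y z
  proof -
    have "?g (D x y) z = (\<Sum>i=1..5. K x y (e i) * coframe e i z)"
      unfolding D_def
      by (subst linear_sum[of "\<lambda>v. ?g v z"])
        (use bg in \<open>auto simp: bilinear_def gs frame_metric_sym[of e _ z] frame_metric_basis[OF fr] intro!: sum.cong\<close>)
    also have "\<dots> = K x y (\<Sum>i=1..5. coframe e i z *\<^sub>R e i)"
      by (simp add: linear_sum[OF K_lin] K_scale mult.commute)
    also have "\<dots> = K x y z" by (simp only: frame_expansion[OF fr])
    finally show ?thesis .
  qed
  have "is_levi_civita br e D"
    unfolding is_levi_civita_def
  proof (intro conjI allI)
    show "bilinear D"
      unfolding bilinear_def
      by (intro conjI allI linearI; rule frame_metric_eqI[OF fr])
        (simp_all add: gs gD, simp_all add: K_def gs bs field_simps)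
    fix x y z
    show "cov2 D ?g x y z = 0"
      using skew[of x y] skew[of x z] skew[of y z]
      by (simp add: cov2_def gD frame_metric_sym[of e y]) (simp add: K_def gs field_simps)
    show "D x y - D y x = br x y"
    proof (rule frame_metric_eqI[OF fr])
      fix u
      show "?g (D x y - D y x) u = ?g (br x y) u"
        using skew[of x y] skew[of u x] skew[of u y] by (simp add: gs gD) (simp add: K_def gs field_simps)
    qed
  qed
  moreover have "D' = D" if "is_levi_civita br e D'" for D'
  proof (intro ext)
    fix x y
    have m: "?g (D' a b) c = - ?g (D' a c) b" and t: "?g (D' a b) c = ?g (D' b a) c + ?g (br a b) c"
      for a b c
    proof -
      have "cov2 D' ?g a b c = 0" "D' a b - D' b a = br a b"
        using that unfolding is_levi_civita_def by blast+
      then have eq: "D' a b = D' b a + br a b" by (simp add: diff_eq_eq add.commute)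
      show "?g (D' a b) c = - ?g (D' a c) b"
        using \<open>cov2 D' ?g a b c = 0\<close>
        by (simp add: cov2_def frame_metric_sym[of e b])
      show "?g (D' a b) c = ?g (D' b a) c + ?g (br a b) c"
        by (subst eq) (simp add: gs)
    qed
    have "?g (D' x y) z = K x y z" for z
      using t[of x y z] t[of y z x] t[of z x y] m[of x y z] m[of y z x] m[of z x y]
      by (simp add: K_def)
    then show "D' x y = D x y" by (intro frame_metric_eqI[OF fr]) (simp add: gD)
  qed
  ultimately show ?thesis by blast
qed

lemma is_levi_civita_levi_civita:
  "frame e \<Longrightarrow> lie_algebra br \<Longrightarrow> is_levi_civita br e (levi_civita br e)"
  unfolding levi_civita_def using ex1_levi_civita by (rule theI')

lemma ext_deriv_2:
  "ext_deriv br w [x, y, z] = - w [br x y, z] + w [br x z, y] - w [br y z, x]"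
  by (simp add: ext_deriv_def lessThan_Suc numeral_eq_Suc nths_Cons)

lemma ext_deriv_3:
  "ext_deriv br w [x, y, z, u] =
     - w [br x y, z, u] + w [br x z, y, u] - w [br x u, y, z]
     - w [br y z, x, u] + w [br y u, x, z] - w [br z u, x, y]"
  by (simp add: ext_deriv_def lessThan_Suc numeral_eq_Suc nths_Cons)

end

theory Submission
  imports Defs
begin

text \<open>
  The characteristic connection takes values in the irreducible \<open>so(3)\<close>, so the hypotheses on
  \<open>h\<close> and \<open>p\<close> leave 7 parameters for it and 10 for the torsion, and
  \<open>[x, y] = D x y - D y x - T(x, y)\<close>. The pair is symmetric iff the six torsion coefficients of
  type \<open>(h, h, p)\<close> vanish. The Jacobi identities of odd type are linear in these six; combined
  over the reals with those of even type, they force all connection parameters to vanish as soon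
  as one of the six is nonzero.

  Then \<open>T(x, y, z) = - g([x, y], z)\<close> is totally skew, i.e. the metric is bi-invariant. Jacobi
  gives \<open>dT = 0\<close>, and \<open>d*T = 0\<close> is an identity in the coefficients of \<open>T\<close>. In dimension 5 Jacobi
  also says that \<open>T\<close> is decomposable, so the commutator algebra is 3-dimensional, and averaging
  the resulting exchange relation over the frame writes every bracket as a bracket of
  commutators.
\<close>

declare One_nat_def [simp del]

lemma lie_algebra_skew:
  assumes "lie_algebra br"
  shows "br y x = - br x y"
proof -
  have b: "bilinear br" using assms by (simp add: lie_algebra_def)
  have "br (x + y) (x + y) = 0" "br x x = 0" "br y y = 0"
    using assms by (auto simp: lie_algebra_def)
  then have "br x y + br y x = 0"
    by (simp add: bilinear_ladd[OF b] bilinear_radd[OF b] add.commute)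
  then show ?thesis by (rule minus_unique[symmetric])
qed

section \<open>Jacobi identities in the adapted frame\<close>

text \<open>
  The frame \<open>f\<close> is the adapted one with \<open>f 1 = e 1 / sqrt 3\<close>, which makes all structure
  constants rational. The connection acts on \<open>f\<close> through \<open>a1, a2, a4\<close> (along \<open>h\<close>) and \<open>p, q\<close>,
  \<open>r, s\<close> (along \<open>f 3\<close>, \<open>f 5\<close>). The torsion coefficients are \<open>t\<close> for (1,2,4), \<open>ui\<close> for (i,3,5),
  \<open>mij\<close> for (1,i,j) and \<open>n3\<close>, \<open>n5\<close> for (2,3,4), (2,4,5); the pair is symmetric iff all \<open>m\<close> and
  \<open>n\<close> vanish. The equation \<open>jac_ijkl\<close> below is the \<open>f l\<close> component of the Jacobi identity for
  \<open>f i, f j, f k\<close>.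
\<close>

locale so3_bracket =
  fixes br :: "'a::real_vector \<Rightarrow> 'a \<Rightarrow> 'a" and f :: "nat \<Rightarrow> 'a" and c :: "nat \<Rightarrow> 'a \<Rightarrow> real"
    and a1 a2 a4 p q r s t u1 u2 u4 m23 m25 m34 m45 n3 n5 :: real
  assumes lie: "lie_algebra br"
    and lin: "linear (c i)"
    and dual: "i \<in> {1..5} \<Longrightarrow> j \<in> {1..5} \<Longrightarrow> c i (f j) = (if i = j then 1 else 0)"
    and br12: "br (f 1) (f 2) = (- m23) *\<^sub>R f 3 + (- 2 * a1 - t) *\<^sub>R f 4 + (- m25) *\<^sub>R f 5"
    and br13: "br (f 1) (f 3) = m23 *\<^sub>R f 2 + p *\<^sub>R f 3 + (- m34) *\<^sub>R f 4 + (- a1 + q - u1) *\<^sub>R f 5"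
    and br14: "br (f 1) (f 4) = (2 * a1 + t) *\<^sub>R f 2 + m34 *\<^sub>R f 3 + (- m45) *\<^sub>R f 5"
    and br15: "br (f 1) (f 5) = m25 *\<^sub>R f 2 + (a1 + r + u1) *\<^sub>R f 3 + m45 *\<^sub>R f 4 + s *\<^sub>R f 5"
    and br23: "br (f 2) (f 3) = (- 3 * m23) *\<^sub>R f 1 + q *\<^sub>R f 3 + (- n3) *\<^sub>R f 4 + (- a2 + p - u2) *\<^sub>R f 5"
    and br24: "br (f 2) (f 4) = (- 3 * t) *\<^sub>R f 1 + (2 * a2) *\<^sub>R f 2 + n3 *\<^sub>R f 3 + (2 * a4) *\<^sub>R f 4
        + (- n5) *\<^sub>R f 5"
    and br25: "br (f 2) (f 5) = (- 3 * m25) *\<^sub>R f 1 + (a2 + s + u2) *\<^sub>R f 3 + n5 *\<^sub>R f 4 + r *\<^sub>R f 5"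
    and br34: "br (f 3) (f 4) = (- 3 * m34) *\<^sub>R f 1 + (- n3) *\<^sub>R f 2 + p *\<^sub>R f 3 + (a4 - q - u4) *\<^sub>R f 5"
    and br35: "br (f 3) (f 5) = (3 * q - 3 * r - 3 * u1) *\<^sub>R f 1 + (p - s - u2) *\<^sub>R f 2 + (q + r
        + u4) *\<^sub>R f 4"
    and br45: "br (f 4) (f 5) = (- 3 * m45) *\<^sub>R f 1 + (- n5) *\<^sub>R f 2 + (a4 - r - u4) *\<^sub>R f 3 + s *\<^sub>R f 5"
begin

lemma jacobi_coord:
  "c m (br (f i) (br (f j) (f l))) + c m (br (f j) (br (f l) (f i))) + c m (br (f l) (br (f i) (f j)))
      = 0"
proof -
  have "c m (br (f i) (br (f j) (f l)) + br (f j) (br (f l) (f i)) + br (f l) (br (f i) (f j))) = 0"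
    using lie lin[of m] by (simp add: lie_algebra_def linear_0)
  then show ?thesis by (simp add: linear_add[OF lin])
qed

lemma bilin: "bilinear br"
  using lie by (simp add: lie_algebra_def)

lemma skew: "br y x = - br x y"
  by (rule lie_algebra_skew[OF lie])

lemmas coord_simps = bilinear_radd[OF bilin] bilinear_rmul[OF bilin] linear_add[OF lin]
  linear_scale[OF lin]
  linear_neg[OF lin] bilinear_rneg[OF bilin] bilinear_rsub[OF bilin] linear_diff[OF lin] dual
  br12 br13 br14 br15 br23 br24 br25 br34 br35 br45
  skew[of "f 2" "f 1", unfolded br12]
  skew[of "f 3" "f 1", unfolded br13]
  skew[of "f 4" "f 1", unfolded br14]
  skew[of "f 5" "f 1", unfolded br15]
  skew[of "f 3" "f 2", unfolded br23]
  skew[of "f 4" "f 2", unfolded br24]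
  skew[of "f 5" "f 2", unfolded br25]
  skew[of "f 4" "f 3", unfolded br34]
  skew[of "f 5" "f 3", unfolded br35]
  skew[of "f 5" "f 4", unfolded br45]

lemma br_same: "br x x = 0"
  using lie by (simp add: lie_algebra_def)

section \<open>Components of the Jacobi identity, of odd and of even type\<close>

lemma jac_1231: "- a1 * m25 + 2 * a1 * m34 + m23 * p + m25 * r = 0"
  using jacobi_coord[of 1 1 2 3] by (simp add: coord_simps br_same) algebra

lemma jac_1232: "- a2 * m25 + 2 * a2 * m34 + m23 * q + m25 * s = 0"
  using jacobi_coord[of 2 1 2 3] by (simp add: coord_simps br_same) algebra

lemma jac_1234: "a1 * n5 - a2 * m45 + 2 * a4 * m34 - m25 * q - m25 * r - m25 * u4 - m34 * q + m45 * p
    - m45 * u2 + n3 * p - n5 * q + n5 * u1 = 0"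
  using jacobi_coord[of 4 1 2 3] by (simp add: coord_simps br_same) algebra

lemma jac_1243: "- a1 * n5 - 2 * a2 * m23 + a2 * m45 - a4 * m25 + 2 * a4 * m34 + m23 * p + m25 * r
    + m25 * u4 - m34 * q + m45 * s + m45 * u2 + n3 * p - n5 * r - n5 * u1 = 0"
  using jacobi_coord[of 3 1 2 4] by (simp add: coord_simps br_same) algebra

lemma jac_1245: "- a1 * n3 - 2 * a2 * m25 + a2 * m34 + a4 * m23 - 2 * a4 * m45 - m23 * q - m23 * u4
    - m25 * s - m34 * p + m34 * u2 + m45 * r + n3 * q - n3 * u1 - n5 * s = 0"
  using jacobi_coord[of 5 1 2 4] by (simp add: coord_simps br_same) algebra

lemma jac_1251: "a1 * m23 - 2 * a1 * m45 + m23 * q + m25 * s = 0"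
  using jacobi_coord[of 1 1 2 5] by (simp add: coord_simps br_same) algebra

lemma jac_1252: "a2 * m23 - 2 * a2 * m45 + m23 * p + m25 * r = 0"
  using jacobi_coord[of 2 1 2 5] by (simp add: coord_simps br_same) algebra

lemma jac_1254: "a1 * n3 - a2 * m34 - 2 * a4 * m45 + m23 * q + m23 * r + m23 * u4 - m34 * s - m34 * u2
    + m45 * r + n3 * r + n3 * u1 - n5 * s = 0"
  using jacobi_coord[of 4 1 2 5] by (simp add: coord_simps br_same) algebra

lemma jac_1341: "- 2 * a1 * m23 + a1 * m45 + m34 * p - m45 * r = 0"
  using jacobi_coord[of 1 1 3 4] by (simp add: coord_simps br_same) algebra

lemma jac_1342: "a1 * n5 - 2 * a2 * m23 + a4 * m25 + m23 * p - m25 * q - m25 * u4 + m45 * p - m45 * s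
    - m45 * u2 + n3 * p - n5 * q + n5 * u1 = 0"
  using jacobi_coord[of 2 1 3 4] by (simp add: coord_simps br_same) algebra

lemma jac_1344: "- 2 * a4 * m23 + a4 * m45 - m34 * p + m45 * r = 0"
  using jacobi_coord[of 4 1 3 4] by (simp add: coord_simps br_same) algebra

lemma jac_1353: "- a2 * m23 + a4 * m34 - m23 * p + m25 * q + m34 * q - m45 * p = 0"
  using jacobi_coord[of 3 1 3 5] by (simp add: coord_simps br_same) algebra

lemma jac_1355: "- a2 * m25 - a4 * m45 - m23 * r + m25 * s + m34 * s - m45 * r = 0"
  using jacobi_coord[of 5 1 3 5] by (simp add: coord_simps br_same) algebra

lemma jac_1451: "2 * a1 * m25 - a1 * m34 - m34 * q + m45 * s = 0"
  using jacobi_coord[of 1 1 4 5] by (simp add: coord_simps br_same) algebra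

lemma jac_1452: "- a1 * n3 + 2 * a2 * m25 + a4 * m23 - m23 * r - m23 * u4 + m25 * s - m34 * p + m34 * s
    + m34 * u2 - n3 * r - n3 * u1 + n5 * s = 0"
  using jacobi_coord[of 2 1 4 5] by (simp add: coord_simps br_same) algebra

lemma jac_1454: "2 * a4 * m25 - a4 * m34 - m34 * q + m45 * s = 0"
  using jacobi_coord[of 4 1 4 5] by (simp add: coord_simps br_same) algebra

lemma jac_2341: "- 2 * a2 * m23 + a2 * m45 - a4 * m25 + 2 * a4 * m34 - m23 * p + m25 * q + m25 * u4
    + m34 * q - m45 * p + m45 * u2 + n5 * q - n5 * r - n5 * u1 = 0"
  using jacobi_coord[of 1 2 3 4] by (simp add: coord_simps br_same) algebra

lemma jac_2342: "6 * a1 * m23 + a2 * n5 + 2 * a4 * n3 + n3 * q - n5 * s = 0"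
  using jacobi_coord[of 2 2 3 4] by (simp add: coord_simps br_same) algebra

lemma jac_2344: "- 6 * a1 * m34 - 2 * a2 * n3 + a4 * n5 - n3 * p + n5 * r = 0"
  using jacobi_coord[of 4 2 3 4] by (simp add: coord_simps br_same) algebra

lemma jac_2353: "3 * a1 * m23 + a4 * n3 + 3 * m23 * q - 3 * m25 * p + n3 * q - n5 * p = 0"
  using jacobi_coord[of 3 2 3 5] by (simp add: coord_simps br_same) algebra

lemma jac_2355: "3 * a1 * m25 - a4 * n5 + 3 * m23 * s - 3 * m25 * r + n3 * s - n5 * r = 0"
  using jacobi_coord[of 5 2 3 5] by (simp add: coord_simps br_same) algebra

lemma jac_2451: "2 * a2 * m25 - a2 * m34 - a4 * m23 + 2 * a4 * m45 + m23 * r + m23 * u4 - m25 * s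
    - m34 * s - m34 * u2 + m45 * r - n3 * q + n3 * r + n3 * u1 = 0"
  using jacobi_coord[of 1 2 4 5] by (simp add: coord_simps br_same) algebra

lemma jac_2452: "- 6 * a1 * m25 - a2 * n3 + 2 * a4 * n5 - n3 * p + n5 * r = 0"
  using jacobi_coord[of 2 2 4 5] by (simp add: coord_simps br_same) algebra

lemma jac_2454: "- 6 * a1 * m45 - 2 * a2 * n5 - a4 * n3 - n3 * q + n5 * s = 0"
  using jacobi_coord[of 4 2 4 5] by (simp add: coord_simps br_same) algebra

lemma jac_3453: "3 * a1 * m34 + a2 * n3 + 3 * m34 * q + 3 * m45 * p + n3 * p + n5 * q = 0"
  using jacobi_coord[of 3 3 4 5] by (simp add: coord_simps br_same) algebra

lemma jac_3455: "- 3 * a1 * m45 - a2 * n5 + 3 * m34 * s + 3 * m45 * r + n3 * r + n5 * s = 0"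
  using jacobi_coord[of 5 3 4 5] by (simp add: coord_simps br_same) algebra

lemma jac_1233: "- a1 * p + a1 * s - a2 * q - a2 * r + p * r - p * t + p * u1 - q * s - q * u2 - r * u2
    + s * u1 = 0"
  using jacobi_coord[of 3 1 2 3] by (simp add: coord_simps br_same) algebra

lemma jac_1235: "- 2 * a1 * a4 + a1 * q + a1 * r + 2 * a1 * u4 + a2 * p - a2 * s - a4 * t - m34 * n5
    + m45 * n3 - p * p + p * s + p * u2 + q * q - q * r + q * t - q * u1 + r * u1 - s * u2 + t * u4 = 0"
  using jacobi_coord[of 5 1 2 3] by (simp add: coord_simps br_same) algebra

lemma jac_1253: "2 * a1 * a4 - a1 * q - a1 * r - 2 * a1 * u4 + a2 * p - a2 * s + a4 * t + m34 * n5
    - m45 * n3 + p * s + p * u2 - q * r - q * u1 + r * r - r * t + r * u1 - s * s - s * u2 - t * u4 = 0"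
  using jacobi_coord[of 3 1 2 5] by (simp add: coord_simps br_same) algebra

lemma jac_1255: "- a1 * p + a1 * s + a2 * q + a2 * r - p * r - p * u1 + q * s + q * u2 + r * u2 + s * t
    - s * u1 = 0"
  using jacobi_coord[of 5 1 2 5] by (simp add: coord_simps br_same) algebra

lemma jac_1343: "a1 * q + a1 * r + a4 * q + a4 * r - 2 * q * r + q * t - q * u1 - q * u4 + r * u1
    - r * u4 = 0"
  using jacobi_coord[of 3 1 3 4] by (simp add: coord_simps br_same) algebra

lemma jac_1345: "- 2 * a1 * a2 + a1 * p - a1 * s - 2 * a1 * u2 - a2 * t - a4 * p + a4 * s + m23 * n5
    + m25 * n3 + 2 * p * q + p * t - p * u1 + p * u4 - s * u1 - s * u4 - t * u2 = 0"
  using jacobi_coord[of 5 1 3 4] by (simp add: coord_simps br_same) algebra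

lemma jac_1351: "- p * q + p * r + p * u1 - q * s + r * s + s * u1 = 0"
  using jacobi_coord[of 1 1 3 5] by (simp add: coord_simps br_same) algebra

lemma jac_1352: "2 * a1 * q + 2 * a1 * r + 2 * a1 * u4 - m34 * n5 + m45 * n3 - p * p + p * u2 + q * t
    + r * t + s * s + s * u2 + t * u4 = 0"
  using jacobi_coord[of 2 1 3 5] by (simp add: coord_simps br_same) algebra

lemma jac_1354: "- 2 * a1 * p + 2 * a1 * s + 2 * a1 * u2 - m23 * n5 - m25 * n3 - p * q - p * r - p * t
    - p * u4 - q * s - r * s + s * t - s * u4 + t * u2 = 0"
  using jacobi_coord[of 4 1 3 5] by (simp add: coord_simps br_same) algebra

lemma jac_1453: "- 2 * a1 * a2 + a1 * p - a1 * s - 2 * a1 * u2 - a2 * t + a4 * p - a4 * s + m23 * n5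
    + m25 * n3 + p * u1 - p * u4 + 2 * r * s - s * t + s * u1 + s * u4 - t * u2 = 0"
  using jacobi_coord[of 3 1 4 5] by (simp add: coord_simps br_same) algebra

lemma jac_1455: "- a1 * q - a1 * r + a4 * q + a4 * r - 2 * q * r - q * u1 - q * u4 - r * t + r * u1
    - r * u4 = 0"
  using jacobi_coord[of 5 1 4 5] by (simp add: coord_simps br_same) algebra

lemma jac_2343: "a2 * q + a2 * r - a4 * p + a4 * s - p * r - 3 * p * t - p * u4 - q * s - q * u2
    + r * u2 - s * u4 = 0"
  using jacobi_coord[of 3 2 3 4] by (simp add: coord_simps br_same) algebra

lemma jac_2345: "3 * a1 * t - 2 * a2 * a2 + a2 * p - a2 * s - 2 * a2 * u2 - 2 * a4 * a4 + a4 * q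
    + a4 * r + 2 * a4 * u4 - 3 * m23 * m45 - 3 * m25 * m34 + p * p + p * s - p * u2 + q * q - q * r
    - 3 * q * t + q * u4 - r * u4 - s * u2 + 3 * t * u1 = 0"
  using jacobi_coord[of 5 2 3 4] by (simp add: coord_simps br_same) algebra

lemma jac_2351: "m34 * n5 - m45 * n3 - q * q - q * t + q * u1 + r * r - r * t + r * u1 - t * u4 = 0"
  using jacobi_coord[of 1 2 3 5] by (simp add: coord_simps br_same) algebra

lemma jac_2352: "2 * a2 * q + 2 * a2 * r + 2 * a2 * u4 - p * q - p * r + q * s + q * u2 + r * s + r * u2
    = 0"
  using jacobi_coord[of 2 2 3 5] by (simp add: coord_simps br_same) algebra

lemma jac_2354: "6 * a1 * q - 6 * a1 * r - 6 * a1 * u1 + 2 * a4 * q + 2 * a4 * r + 2 * a4 * u4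
    + 3 * m23 * m45 + 3 * m25 * m34 - q * q - 2 * q * r + 3 * q * t - q * u4 - r * r - 3 * r * t
    - r * u4 - 3 * t * u1 = 0"
  using jacobi_coord[of 4 2 3 5] by (simp add: coord_simps br_same) algebra

lemma jac_2453: "3 * a1 * t - 2 * a2 * a2 + a2 * p - a2 * s - 2 * a2 * u2 - 2 * a4 * a4 + a4 * q
    + a4 * r + 2 * a4 * u4 - 3 * m23 * m45 - 3 * m25 * m34 + p * s + p * u2 - q * r - q * u4 + r * r
    + 3 * r * t + r * u4 + s * s + s * u2 + 3 * t * u1 = 0"
  using jacobi_coord[of 3 2 4 5] by (simp add: coord_simps br_same) algebra

lemma jac_2455: "- a2 * q - a2 * r + a4 * p - a4 * s - p * r - p * u4 - q * s - q * u2 + r * u2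
    + 3 * s * t - s * u4 = 0"
  using jacobi_coord[of 5 2 4 5] by (simp add: coord_simps br_same) algebra

lemma jac_3452: "6 * a1 * q - 6 * a1 * r - 6 * a1 * u1 + 2 * a2 * p - 2 * a2 * s - 2 * a2 * u2
    + 3 * m23 * m45 + 3 * m25 * m34 - p * p + 2 * p * s + p * u2 + 3 * q * t - 3 * r * t - s * s
    - s * u2 - 3 * t * u1 = 0"
  using jacobi_coord[of 2 3 4 5] by (simp add: coord_simps br_same) algebra

lemma jac_3454: "2 * a4 * p - 2 * a4 * s - 2 * a4 * u2 - p * q - p * r - p * u4 + q * s + r * s + s * u4
    = 0"
  using jacobi_coord[of 4 3 4 5] by (simp add: coord_simps br_same) algebra

text \<open>Parity counts the indices from {3, 5}. Changing the sign of \<open>f 3\<close> and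
  \<open>f 5\<close> flips exactly the coefficients \<open>m\<close> and \<open>n\<close>, so every
  term here contains exactly one of them, while the terms of \<open>jacobi_even\<close> contain none
  or two.\<close>

lemmas jacobi_odd =
  jac_1231 jac_1232 jac_1234 jac_1243 jac_1245 jac_1251 jac_1252 jac_1254 jac_1341
  jac_1342 jac_1344 jac_1353 jac_1355 jac_1451 jac_1452 jac_1454 jac_2341 jac_2342
  jac_2344 jac_2353 jac_2355 jac_2451 jac_2452 jac_2454 jac_3453 jac_3455

lemmas jacobi_even =
  jac_1233 jac_1235 jac_1253 jac_1255 jac_1343 jac_1345 jac_1351 jac_1352 jac_1354
  jac_1453 jac_1455 jac_2343 jac_2345 jac_2351 jac_2352 jac_2354 jac_2453 jac_2455
  jac_3452 jac_3454

section \<open>Solving the Jacobi system over the reals\<close>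

text \<open>The odd identities combine to \<open>n3^2 + n5^2\<close> times a connection parameter
  being zero, and over the reals this factor is positive. The order is \<open>a2\<close>,
  \<open>a4\<close>, then \<open>p\<close>, \<open>q\<close>, \<open>r\<close>, \<open>s\<close>,
  then \<open>a1\<close>, because each stage uses the earlier zeros.\<close>

lemma vanishing_if_m_zero:
  assumes m: "m23 = 0" "m25 = 0" "m34 = 0" "m45 = 0" and n: "n3 \<noteq> 0 \<or> n5 \<noteq> 0"
  shows "a1 = 0 \<and> a2 = 0 \<and> a4 = 0 \<and> p = 0 \<and> q = 0 \<and> r = 0 \<and> s = 0"
proof -
  have N: "n3\<^sup>2 + n5\<^sup>2 \<noteq> 0" using n by (simp add: sum_power2_eq_zero_iff)
  have "(n3\<^sup>2 + n5\<^sup>2) * a2 = 0" "(n3\<^sup>2 + n5\<^sup>2) * a4 = 0"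
    using m jac_2342 jac_2454 jac_2344 jac_2452 by algebra+
  then have a: "a2 = 0" "a4 = 0" using N by auto
  have "(n3\<^sup>2 + n5\<^sup>2) * p = 0" "(n3\<^sup>2 + n5\<^sup>2) * q = 0" "(n3\<^sup>2 + n5\<^sup>2) * r = 0" "(n3\<^sup>2 + n5\<^sup>2) * s = 0"
    using m a jac_2342 jac_2344 jac_2353 jac_2355 jac_3453 jac_3455 by algebra+
  then have b: "p = 0" "q = 0" "r = 0" "s = 0" using N by auto
  \<comment> \<open>By now \<open>jac_1234\<close> and \<open>jac_1254\<close> read
    \<open>n5 * (a1 + u1) = 0\<close> and \<open>n3 * (a1 + u1) = 0\<close>; the other two
    identities remove \<open>u1\<close>.\<close>
  have "(n3\<^sup>2 + n5\<^sup>2) * a1 = 0"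
    using m a b jac_1234 jac_1254 jac_2341 jac_2451 by algebra
  then show ?thesis using N a b by auto
qed

text \<open>The relations \<open>X\<close> are combinations of the odd identities from which
  everything but the \<open>a\<close> and the \<open>m\<close> has been eliminated. If
  \<open>a2\<close>, \<open>a4\<close> were not both zero, a sum of two squares would kill first the
  differences of the \<open>m\<close>, then the \<open>m\<close> themselves.\<close>

lemma a_zero_if_m_nonzero:
  assumes m: "m23 \<noteq> 0 \<or> m25 \<noteq> 0 \<or> m34 \<noteq> 0 \<or> m45 \<noteq> 0"
  shows "a1 = 0 \<and> a2 = 0 \<and> a4 = 0"
proof -
  have X: "a2 * m25 - a2 * m34 + a4 * m23 - a4 * m45 = 0"
      "a2 * m23 - a2 * m45 - a4 * m25 + a4 * m34 = 0"
    "3 * a1 * m23 + a2 * m34 + 5 * a4 * m23 - 3 * a4 * m45 = 0"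
    "3 * a1 * m25 + a2 * m45 - 5 * a4 * m25 + 3 * a4 * m34 = 0"
    "3 * a1 * m45 + 2 * a2 * m34 + 4 * a4 * m23 - 3 * a4 * m45 = 0"
    "3 * a1 * m34 + 2 * a2 * m45 - 4 * a4 * m25 + 3 * a4 * m34 = 0"
    using jacobi_odd by algebra+
  have a: "a2 = 0 \<and> a4 = 0"
  proof (rule ccontr)
    assume "\<not> ?thesis"
    then have N: "a2\<^sup>2 + a4\<^sup>2 \<noteq> 0" by (simp add: sum_power2_eq_zero_iff)
    \<comment> \<open>With \<open>u = m25 - m34\<close> and \<open>v = m23 - m45\<close> the first
      two relations are \<open>a2 * u + a4 * v = 0\<close> and \<open>a2 * v - a4 * u = 0\<close>, a
      system of determinant \<open>a2^2 + a4^2\<close> up to sign.\<close>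
    have "(a2\<^sup>2 + a4\<^sup>2) * (m25 - m34) = 0" "(a2\<^sup>2 + a4\<^sup>2) * (m23 - m45) = 0"
      using X(1,2) by algebra+
    then have eq: "m34 = m25" "m45 = m23" using N by auto
    \<comment> \<open>Subtracting \<open>X(5)\<close> from \<open>X(3)\<close> and
      \<open>X(6)\<close> from \<open>X(4)\<close> removes \<open>a1\<close> and leaves a system
      with the same determinant for \<open>m25\<close>, \<open>m23\<close>.\<close>
    have "(a2\<^sup>2 + a4\<^sup>2) * m25 = 0" "(a2\<^sup>2 + a4\<^sup>2) * m23 = 0"
      using X(3-6) eq by algebra+
    then show False using N m eq by auto
  qed
  with X m show ?thesis by auto
qed

text \<open>Once the \<open>a\<close> vanish, the identities separate: \<open>t\<close> is free of
  \<open>m\<close> and \<open>n\<close>, \<open>n\<close> is free of the \<open>m\<close>, and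
  \<open>mm\<close> is free of \<open>n3\<close>, \<open>n5\<close>. A nonzero \<open>n3\<close> or
  \<open>n5\<close> gives \<open>q = r\<close> and \<open>p * s = r * r\<close>; otherwise a nonzero
  \<open>m\<close> gives \<open>p = - s\<close>. The quadratic relations \<open>t\<close> then
  decide each case.\<close>

lemma vanishing_if_m_nonzero:
  assumes m: "m23 \<noteq> 0 \<or> m25 \<noteq> 0 \<or> m34 \<noteq> 0 \<or> m45 \<noteq> 0"
  shows "p = 0 \<and> q = 0 \<and> r = 0 \<and> s = 0"
proof -
  have a: "a1 = 0" "a2 = 0" "a4 = 0" using a_zero_if_m_nonzero[OF m] by auto
  have t: "p * t = 0" "s * t = 0" "q * t + r * t = 0" "q * u2 = 0" "r * u2 = 0" "p * q - r * s = 0"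
      "p * r + s * u4 = 0" "q * u4 = r * u4"
    "6 * q * r + 3 * r * t - 6 * r * u1 + 6 * s * u2 = 0"
        "3 * q * u1 + 3 * r * u1 + 6 * r * u4 - 6 * s * u2 = 0"
        "6 * p * p - 6 * r * r - 3 * r * t - 12 * r * u1 + 6 * r * u4 = 0"
    "6 * q * q + 3 * r * t + 12 * r * u1 + 18 * r * u4 - 6 * s * s - 24 * s * u2 = 0"
        "p * s - r * t - r * u1 - r * u4 + s * u2 = 0"
    using jacobi_even a by algebra+
  have n: "n3 * p = n5 * r" "n3 * q = n5 * s" "n5 * q = n5 * r" "n3 * r = n5 * s"
    using jacobi_odd a by algebra+
  have mm: "m23 * p + m25 * r = 0" "m23 * q + m25 * s = 0" "m34 * p = m45 * r" "m34 * q = m45 * s"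
    using jacobi_odd a by algebra+
  show ?thesis
  proof (cases "n3 = 0 \<and> n5 = 0")
    case False
    then have N: "n3\<^sup>2 + n5\<^sup>2 \<noteq> 0" by (simp add: sum_power2_eq_zero_iff)
    have q: "q = r" using n False by auto
    \<comment> \<open>The nonzero vector \<open>(n3, - n5)\<close> lies in the kernel of the matrix
      with rows \<open>(p, r)\<close> and \<open>(r, s)\<close>, so its determinant
      vanishes.\<close>
    have "(n3\<^sup>2 + n5\<^sup>2) * (p * s - r * r) = 0" using n by algebra
    then have ps: "p * s = r * r" using N by auto
    show ?thesis
    proof (cases "r = 0")
      case True
      then have "p * p = 0" using t(11) by simp
      then have "p = 0" by simp
      then have "s * s = 0" using t q True by algebra
      then show ?thesis using True q \<open>p = 0\<close> by simp
    next
      case False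
      then have "p = s" "t = 0" "u2 = 0" using t q by auto
      then have "u1 = r" using t(9) q False by (auto simp: algebra_simps)
      have "r * (u4 + r) = 0"
        using t(10) \<open>u1 = r\<close> \<open>u2 = 0\<close> q by (simp add: algebra_simps del: mult_eq_0_iff)
      then have "u4 = - r" using False by simp
      have "r * r = 0" using t(11) ps \<open>p = s\<close> \<open>t = 0\<close> \<open>u1 = r\<close> \<open>u4 = - r\<close> by simp
      then show ?thesis using False by simp
    qed
  next
    case True
    have x: "m25 * q + m25 * r + 2 * m45 * s = 0" "m23 * r - m25 * s + 2 * m45 * r = 0"
        "m25 * p + m25 * s = 0" "m23 * s - m25 * r = 0" "m45 * p + m45 * s = 0" "m34 * s + m45 * r = 0"
      using jacobi_odd a True by algebra+
    have "m23 * (p + s) = 0" "m25 * (p + s) = 0" "m34 * (p + s) = 0" "m45 * (p + s) = 0"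
      using x mm by algebra+
    then have ps: "p = -s" using m by auto
    show ?thesis
    proof (cases "s = 0")
      case True
      have r: "r * r = 0 \<and> q * q = 0"
      proof (cases "q = 0")
        case True
        then show ?thesis using t ps \<open>s = 0\<close> by algebra
      next
        case False
        then have "r = 0" using mm True ps m by auto
        then show ?thesis using t(12) True by simp
      qed
      then show ?thesis using ps True by simp
    next
      case False
      have "s * (q + r) = 0" using t(6) ps by algebra
      then have q: "q = - r" using False by simp
      have "s * (u4 - r) = 0" using t(7) ps by algebra
      then have "u4 = r" using False by simp
      then have "r = 0" using t(8) q by simp
      then show ?thesis using x q False m by auto
    qed
  qed
qed

lemma connection_vanishes:
  assumes "m23 \<noteq> 0 \<or> m25 \<noteq> 0 \<or> m34 \<noteq> 0 \<or> m45 \<noteq> 0 \<or> n3 \<noteq> 0 \<or> n5 \<noteq> 0"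
  shows "a1 = 0" "a2 = 0" "a4 = 0" "p = 0" "q = 0" "r = 0" "s = 0"
  using assms vanishing_if_m_zero a_zero_if_m_nonzero vanishing_if_m_nonzero by blast+

end

section \<open>Metric connections with values in so(3)\<close>

lemma frame_expand:
  assumes "frame e"
  shows "coframe e 1 x *\<^sub>R e 1 + coframe e 2 x *\<^sub>R e 2 + coframe e 3 x *\<^sub>R e 3
    + coframe e 4 x *\<^sub>R e 4 + coframe e 5 x *\<^sub>R e 5 = x"
proof -
  have "{1..5::nat} = {1, 2, 3, 4, 5}" by auto
  then show ?thesis using frame_expansion[OF assms, of x] by (simp add: add.assoc)
qed

lemma frame_eqI:
  assumes "frame e"
    and "coframe e 1 x = coframe e 1 y" "coframe e 2 x = coframe e 2 y" "coframe e 3 x = coframe e 3 y"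
    "coframe e 4 x = coframe e 4 y" "coframe e 5 x = coframe e 5 y"
  shows "x = y"
proof -
  have "coframe e 1 x *\<^sub>R e 1 + coframe e 2 x *\<^sub>R e 2 + coframe e 3 x *\<^sub>R e 3
      + coframe e 4 x *\<^sub>R e 4 + coframe e 5 x *\<^sub>R e 5 = y"
    unfolding assms(2-) by (rule frame_expand[OF assms(1)])
  then show ?thesis by (simp only: frame_expand[OF assms(1)])
qed

lemma coframe_span_zero:
  assumes "frame e" "i \<in> {1..5}" "x \<in> span (e ` J)" "i \<notin> J" "J \<subseteq> {1..5}"
  shows "coframe e i x = 0"
  using assms(3)
proof (induction rule: span_induct)
  case base
  then show ?case
    using assms coframe_linear[OF assms(1), of i]
    by (simp add: subspace_def linear_0 linear_add linear_scale)
next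
  case (step x)
  then show ?case using assms coframe_basis[OF assms(1,2)] by auto
qed

text \<open>The first slot stays free because a derivative \<open>D x u\<close> is put there when
  \<open>D T = 0\<close> is evaluated.\<close>

lemma so3_tensor_basis:
  assumes "frame e"
  shows "so3_tensor e x (e 1) (e 1) = - coframe e 1 x"
    "so3_tensor e x (e 1) (e 2) = coframe e 2 x"
    "so3_tensor e x (e 1) (e 3) = - coframe e 3 x / 2"
    "so3_tensor e x (e 1) (e 4) = coframe e 4 x"
    "so3_tensor e x (e 1) (e 5) = - coframe e 5 x / 2"
    "so3_tensor e x (e 2) (e 3) = sqrt 3 / 2 * coframe e 5 x"
    "so3_tensor e x (e 2) (e 5) = sqrt 3 / 2 * coframe e 3 x"
    "so3_tensor e x (e 3) (e 3) = - coframe e 1 x / 2 - sqrt 3 / 2 * coframe e 4 x"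
    "so3_tensor e x (e 3) (e 4) = - sqrt 3 / 2 * coframe e 3 x"
    "so3_tensor e x (e 3) (e 5) = sqrt 3 / 2 * coframe e 2 x"
    "so3_tensor e x (e 4) (e 5) = sqrt 3 / 2 * coframe e 5 x"
  by (simp_all add: so3_tensor_explicit[OF assms] coframe_basis[OF assms])

locale characteristic =
  fixes br :: "'a::real_vector \<Rightarrow> 'a \<Rightarrow> 'a" and e :: "nat \<Rightarrow> 'a"
      and D :: "'a \<Rightarrow> 'a \<Rightarrow> 'a"
  assumes lie: "lie_algebra br" and fr: "frame e" and char: "characteristic_connection br e D"
begin

lemma bilin: "bilinear D" "bilinear br"
  using char lie by (simp_all add: characteristic_connection_def lie_algebra_def)

lemma metric_skew:
  assumes "j \<in> {1..5}" "k \<in> {1..5}"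
  shows "coframe e k (D x (e j)) = - coframe e j (D x (e k))"
proof -
  have "cov2 D (frame_metric e) x (e j) (e k) = 0"
    using char by (simp add: characteristic_connection_def)
  then show ?thesis
    using assms by (simp add: cov2_def frame_metric_basis[OF fr] frame_metric_sym[of e "e j"])
qed

text \<open>A skew endomorphism in dimension 5 has ten entries; these seven relations cut out the
  3-dimensional irreducible \<open>so(3)\<close>, the annihilator of the cubic. Each comes from
  evaluating \<open>D T = 0\<close> on one triple of frame vectors.\<close>

lemma so3_relations:
  "coframe e 2 (D x (e 1)) = 0" "coframe e 4 (D x (e 1)) = 0"
  "coframe e 4 (D x (e 2)) = 2 * coframe e 5 (D x (e 3))"
  "coframe e 3 (D x (e 1)) = sqrt 3 * coframe e 5 (D x (e 2))"
  "coframe e 4 (D x (e 3)) = coframe e 5 (D x (e 2))"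
  "coframe e 5 (D x (e 1)) = sqrt 3 * coframe e 3 (D x (e 2))"
  "coframe e 5 (D x (e 4)) = coframe e 3 (D x (e 2))"
proof -
  let ?T = "so3_tensor e"
  \<comment> \<open>Symmetry of the tensor moves the differentiated argument to the first slot in
    all three terms.\<close>
  have cov: "?T (D x u) v w + ?T (D x v) u w + ?T (D x w) u v = 0" for u v w
  proof -
    have "cov3 D ?T x u v w = 0" using char by (simp add: characteristic_connection_def)
    then show ?thesis
      using so3_tensor_sym(1)[of e u "D x v" w] so3_tensor_sym(2)[of e u v "D x w"]
        so3_tensor_sym(1)[of e u "D x w" v]
      by (simp add: cov3_def)
  qed
  have sk: "coframe e 1 (D x (e 1)) = 0" "coframe e 1 (D x (e 2)) = - coframe e 2 (D x (e 1))"
    "coframe e 1 (D x (e 4)) = - coframe e 4 (D x (e 1))"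
        "coframe e 3 (D x (e 5)) = - coframe e 5 (D x (e 3))"
    "coframe e 2 (D x (e 3)) = - coframe e 3 (D x (e 2))"
        "coframe e 2 (D x (e 5)) = - coframe e 5 (D x (e 2))"
    "coframe e 4 (D x (e 5)) = - coframe e 5 (D x (e 4))"
        "coframe e 3 (D x (e 4)) = - coframe e 4 (D x (e 3))"
    using metric_skew[of 1 1 x] metric_skew[of 2 1 x] metric_skew[of 4 1 x] metric_skew[of 5 3 x]
     metric_skew[of 3 2 x] metric_skew[of 5 2 x] metric_skew[of 5 4 x] metric_skew[of 4 3 x]
    by simp_all
  have sym: "?T u (e 2) (e 1) = ?T u (e 1) (e 2)" "?T u (e 4) (e 1) = ?T u (e 1) (e 4)"
     "?T u (e 3) (e 2) = ?T u (e 2) (e 3)" "?T u (e 4) (e 3) = ?T u (e 3) (e 4)" for u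
    by (rule so3_tensor_sym(2))+
  note S = so3_tensor_basis[OF fr] sk sym
  show z: "coframe e 2 (D x (e 1)) = 0" "coframe e 4 (D x (e 1)) = 0"
    using cov[of "e 1" "e 1" "e 2"] cov[of "e 1" "e 1" "e 4"] by (simp_all add: S)
  have c: "sqrt 3 * (sqrt 3 * y) = 3 * y" for y :: real by (simp flip: mult.assoc)
  have cancel: "y = z" if "sqrt 3 * y = sqrt 3 * z" for y z :: real using that by simp
  have "sqrt 3 * coframe e 4 (D x (e 2)) = sqrt 3 * (2 * coframe e 5 (D x (e 3)))"
    using cov[of "e 3" "e 3" "e 2"] z by (simp add: S)
  then show "coframe e 4 (D x (e 2)) = 2 * coframe e 5 (D x (e 3))" by (rule cancel)
  have "sqrt 3 * coframe e 3 (D x (e 1)) = sqrt 3 * (sqrt 3 * coframe e 5 (D x (e 2)))"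
    using cov[of "e 1" "e 2" "e 5"] by (simp add: S c)
  then show A: "coframe e 3 (D x (e 1)) = sqrt 3 * coframe e 5 (D x (e 2))" by (rule cancel)
  have "sqrt 3 * coframe e 5 (D x (e 1)) = sqrt 3 * (sqrt 3 * coframe e 3 (D x (e 2)))"
    using cov[of "e 1" "e 2" "e 3"] by (simp add: S c)
  then show B: "coframe e 5 (D x (e 1)) = sqrt 3 * coframe e 3 (D x (e 2))" by (rule cancel)
  show "coframe e 4 (D x (e 3)) = coframe e 5 (D x (e 2))"
    using cov[of "e 1" "e 4" "e 3"] A by (simp add: S c)
  show "coframe e 5 (D x (e 4)) = coframe e 3 (D x (e 2))"
    using cov[of "e 1" "e 4" "e 5"] B by (simp add: S c)
qed

end

section \<open>The connection and the brackets under the stability hypotheses\<close>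

text \<open>By \<open>so3_relations\<close> these few entries capture the stability hypotheses: the
  entries of \<open>D x (e 1)\<close> along \<open>e 3\<close>, \<open>e 5\<close> control every
  entry between h and p, and the entry of \<open>D x (e 3)\<close> along \<open>e 5\<close> controls
  every entry inside h and inside p.\<close>

locale adapted = characteristic +
  assumes h_stable: "i \<in> {1, 2, 4} \<Longrightarrow> coframe e 3 (D (e i) (e 1)) = 0"
      "i \<in> {1, 2, 4} \<Longrightarrow> coframe e 5 (D (e i) (e 1)) = 0"
    and p_swaps: "i \<in> {3, 5} \<Longrightarrow> coframe e 5 (D (e i) (e 3)) = 0"
begin

lemma coframe_simps:
  "coframe e i 0 = 0" "coframe e i (x + y) = coframe e i x + coframe e i y"
  "coframe e i (x - y) = coframe e i x - coframe e i y" "coframe e i (- x) = - coframe e i x"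
  "coframe e i (c *\<^sub>R x) = c * coframe e i x"
  using coframe_linear[OF fr, of i]
  by (simp_all add: linear_0 linear_add linear_diff linear_neg linear_scale)

lemma metric_same: "i \<in> {1..5} \<Longrightarrow> coframe e i (D x (e i)) = 0"
  using metric_skew[of i i x] by simp

lemma metric_skew_coords:
  "coframe e 1 (D x (e 1)) = 0" "coframe e 2 (D x (e 2)) = 0" "coframe e 3 (D x (e 3)) = 0"
  "coframe e 4 (D x (e 4)) = 0" "coframe e 5 (D x (e 5)) = 0"
  "coframe e 1 (D x (e 2)) = - coframe e 2 (D x (e 1))"
  "coframe e 1 (D x (e 3)) = - coframe e 3 (D x (e 1))"
  "coframe e 1 (D x (e 4)) = - coframe e 4 (D x (e 1))"
  "coframe e 1 (D x (e 5)) = - coframe e 5 (D x (e 1))"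
  "coframe e 3 (D x (e 2)) = - coframe e 2 (D x (e 3))"
  "coframe e 2 (D x (e 4)) = - coframe e 4 (D x (e 2))"
  "coframe e 5 (D x (e 2)) = - coframe e 2 (D x (e 5))"
  "coframe e 3 (D x (e 4)) = - coframe e 4 (D x (e 3))"
  "coframe e 5 (D x (e 3)) = - coframe e 3 (D x (e 5))"
  "coframe e 4 (D x (e 5)) = - coframe e 5 (D x (e 4))"
  by (rule metric_same metric_skew; simp)+

text \<open>What remains along h is the \<open>so(2)\<close> fixing \<open>e 1\<close>: it turns the
  plane of \<open>e 2\<close>, \<open>e 4\<close> twice as fast as that of \<open>e 3\<close>,
  \<open>e 5\<close>.\<close>

lemma connection_h:
  assumes "i \<in> {1, 2, 4}"
  defines "a \<equiv> coframe e 3 (D (e i) (e 5))"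
  shows "D (e i) (e 1) = 0" "D (e i) (e 2) = (- 2 * a) *\<^sub>R e 4" "D (e i) (e 3) = (- a) *\<^sub>R e 5"
    "D (e i) (e 4) = (2 * a) *\<^sub>R e 2" "D (e i) (e 5) = a *\<^sub>R e 3"
  using so3_relations[of "e i"] h_stable[OF assms(1)]
  by - (rule frame_eqI[OF fr]; simp add: coframe_simps coframe_basis[OF fr] metric_skew_coords a_def)+

text \<open>Along p the \<open>so(2)\<close> part vanishes, which leaves the two parameters of its
  complement in \<open>so(3)\<close>.\<close>

lemma connection_p:
  assumes "i \<in> {3, 5}"
  defines "p \<equiv> coframe e 2 (D (e i) (e 5))" and "q \<equiv> coframe e 2 (D (e i) (e 3))"
  shows "D (e i) (e 1) = (- sqrt 3 * p) *\<^sub>R e 3 - (sqrt 3 * q) *\<^sub>R e 5"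
    "D (e i) (e 2) = (- q) *\<^sub>R e 3 - p *\<^sub>R e 5"
    "D (e i) (e 3) = (sqrt 3 * p) *\<^sub>R e 1 + q *\<^sub>R e 2 - p *\<^sub>R e 4"
    "D (e i) (e 4) = p *\<^sub>R e 3 - q *\<^sub>R e 5"
    "D (e i) (e 5) = (sqrt 3 * q) *\<^sub>R e 1 + p *\<^sub>R e 2 + q *\<^sub>R e 4"
  using so3_relations[of "e i"] p_swaps[OF assms(1)]
  by - (rule frame_eqI[OF fr]; simp add: coframe_simps coframe_basis[OF fr] metric_skew_coords p_def
      q_def)+

definition \<tau> :: "nat \<Rightarrow> nat \<Rightarrow> nat \<Rightarrow> real" where
  "\<tau> i j k = torsion_form br e D (e i) (e j) (e k)"

lemma tau_skew: "\<tau> j i k = - \<tau> i j k" "\<tau> i k j = - \<tau> i j k"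
proof -
  have "totally_skew (torsion_form br e D)" using char by (simp add: characteristic_connection_def)
  then show "\<tau> j i k = - \<tau> i j k" "\<tau> i k j = - \<tau> i j k"
    unfolding \<tau>_def totally_skew_def by blast+
qed

lemma tau_cyclic: "\<tau> j k i = \<tau> i j k"
  using tau_skew(1)[of j i k] tau_skew(2)[of j k i] by simp

lemma tau_same: "\<tau> i i j = 0" "\<tau> i j j = 0" "\<tau> i j i = 0"
  using tau_skew(1)[of i i j] tau_skew(2)[of i j j] tau_skew(1)[of i j i] tau_skew(2)[of i i j] by auto

lemma bracket_frame:
  "br (e i) (e j) = D (e i) (e j) - D (e j) (e i) - (\<tau> i j 1 *\<^sub>R e 1 + \<tau> i j 2 *\<^sub>R e 2
     + \<tau> i j 3 *\<^sub>R e 3 + \<tau> i j 4 *\<^sub>R e 4 + \<tau> i j 5 *\<^sub>R e 5)"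
proof -
  have "coframe e k (D (e i) (e j) - D (e j) (e i) - br (e i) (e j)) = \<tau> i j k" if "k \<in> {1..5}" for k
    using that by (simp only: \<tau>_def torsion_form_def frame_metric_basis[OF fr])
  then have "D (e i) (e j) - D (e j) (e i) - br (e i) (e j) = \<tau> i j 1 *\<^sub>R e 1 + \<tau> i j 2 *\<^sub>R e 2
     + \<tau> i j 3 *\<^sub>R e 3 + \<tau> i j 4 *\<^sub>R e 4 + \<tau> i j 5 *\<^sub>R e 5"
    using frame_expand[OF fr, of "D (e i) (e j) - D (e j) (e i) - br (e i) (e j)"] by simp
  then show ?thesis by (metis add_diff_cancel_left' diff_add_cancel)
qed

lemma tau_sort:
  "\<tau> 2 3 1 = \<tau> 1 2 3" "\<tau> 2 4 1 = \<tau> 1 2 4" "\<tau> 2 5 1 = \<tau> 1 2 5" "\<tau> 3 4 1 = \<tau> 1 3 4" "\<tau> 3 5 1 = \<tau> 1 3 5"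
  "\<tau> 4 5 1 = \<tau> 1 4 5" "\<tau> 3 4 2 = \<tau> 2 3 4" "\<tau> 3 5 2 = \<tau> 2 3 5" "\<tau> 4 5 2 = \<tau> 2 4 5" "\<tau> 4 5 3 = \<tau> 3 4 5"
  "\<tau> 1 3 2 = - \<tau> 1 2 3" "\<tau> 1 4 2 = - \<tau> 1 2 4" "\<tau> 1 5 2 = - \<tau> 1 2 5" "\<tau> 1 4 3 = - \<tau> 1 3 4"
      "\<tau> 1 5 3 = - \<tau> 1 3 5"
  "\<tau> 1 5 4 = - \<tau> 1 4 5" "\<tau> 2 4 3 = - \<tau> 2 3 4" "\<tau> 2 5 3 = - \<tau> 2 3 5" "\<tau> 2 5 4 = - \<tau> 2 4 5"
      "\<tau> 3 5 4 = - \<tau> 3 4 5"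
  by (rule tau_cyclic tau_skew(2))+

lemma connection_zero:
  assumes ne: "\<exists>i\<in>{1, 2, 4}. \<exists>j\<in>{1, 2, 4}. \<exists>k\<in>{3, 5}. \<tau> i j k \<noteq> 0"
    and "i \<in> {1..5}" "j \<in> {1..5}"
  shows "D (e i) (e j) = 0"
proof -
  \<comment> \<open>Writing \<open>sqrt 3\<close> as \<open>3 * k\<close> leaves a single irrational
    quantity, whose squares are reduced by \<open>kk\<close>.\<close>
  define k where "k = 1 / sqrt 3"
  have k: "sqrt 3 = 3 * k" "3 * (k * k) = 1" by (simp_all add: k_def field_simps)
  have kk: "k * (k * x) = x / 3" for x
  proof -
    have "k * (k * x) = 3 * (k * k) * x / 3" by simp
    then show ?thesis by (simp only: k(2) mult_1)
  qed
  define f where "f i = (if i = 1 then k *\<^sub>R e 1 else e i)" for i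
  \<comment> \<open>The coordinate dual to \<open>f 1 = k e 1\<close> is that of \<open>e 1\<close>
    divided by \<open>k\<close>, and \<open>1 / k = 3 * k\<close>.\<close>
  define c where "c i x = (if i = 1 then 3 * k * coframe e 1 x else coframe e i x)" for i x
  define a where "a i = coframe e 3 (D (e i) (e 5))" for i
  define p where "p i = coframe e 2 (D (e i) (e 5))" for i
  define q where "q i = coframe e 2 (D (e i) (e 3))" for i
  note D_simps = connection_h[of 1, folded a_def] connection_h[of 2, folded a_def]
    connection_h[of 4, folded a_def] connection_p[of 3, folded p_def q_def]
    connection_p[of 5, folded p_def q_def]
  note B = f_def bilinear_lmul[OF bilin(2)] bilinear_rmul[OF bilin(2)] bracket_frame D_simps
    coframe_simps coframe_basis[OF fr] tau_same tau_sort k(1) kk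
  \<comment> \<open>Each index 1, in a direction of differentiation or a torsion component,
    contributes a factor \<open>k\<close>.\<close>
  interpret b: so3_bracket br f c "k * a 1" "a 2" "a 4" "p 3" "q 3" "p 5" "q 5"
    "k * \<tau> 1 2 4" "k * \<tau> 1 3 5" "\<tau> 2 3 5" "\<tau> 3 4 5"
    "k * \<tau> 1 2 3" "k * \<tau> 1 2 5" "k * \<tau> 1 3 4" "k * \<tau> 1 4 5" "\<tau> 2 3 4" "\<tau> 2 4 5"
  proof (rule so3_bracket.intro, goal_cases)
    case 1
    show ?case by (rule lie)
  next
    case (2 i)
    show ?case by (rule linearI) (simp_all add: c_def coframe_simps algebra_simps)
  next
    case (3 i j)
    then show ?case using k by (auto simp: c_def f_def coframe_simps coframe_basis[OF fr])
  qed (rule frame_eqI[OF fr]; simp add: B algebra_simps)+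
  have "k \<noteq> 0" using k(2) by auto
  \<comment> \<open>Up to skewness these six are all the torsion components of type (h, h,
    p).\<close>
  from ne have "k * \<tau> 1 2 3 \<noteq> 0 \<or> k * \<tau> 1 2 5 \<noteq> 0 \<or> k * \<tau> 1 3 4 \<noteq> 0 \<or> k * \<tau> 1 4 5 \<noteq> 0
      \<or> \<tau> 2 3 4 \<noteq> 0 \<or> \<tau> 2 4 5 \<noteq> 0"
    using \<open>k \<noteq> 0\<close> tau_skew(1)[of 2 1] tau_skew(1)[of 4 1] tau_skew(1)[of 4 2]
    by (auto simp: tau_same tau_sort)
  from b.connection_vanishes[OF this] have z: "a 1 = 0" "a 2 = 0" "a 4 = 0" "p 3 = 0" "q 3 = 0"
      "p 5 = 0" "q 5 = 0"
    using \<open>k \<noteq> 0\<close> by simp_all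
  have "{1..5::nat} = {1, 2, 3, 4, 5}" by auto
  then show ?thesis using assms(2,3) by (auto simp: D_simps z)
qed

end

section \<open>The Hodge star on 3-forms\<close>

lemma atLeastAtMost_1_5: "{1..5::nat} = {1, 2, 3, 4, 5}"
  by auto

text \<open>By duality a term of the determinant survives only if \<open>p\<close> agrees with \<pi>
  on 1, 2, 3. This leaves \<pi> and \<pi> preceded by the swap of 4 and 5, which have opposite
  signs.\<close>

lemma vol_three_frame_vectors:
  assumes fr: "frame e" and \<pi>: "\<pi> permutes {1..5}"
  shows "vol e [e (\<pi> 1), e (\<pi> 2), e (\<pi> 3), y, z]
    = of_int (sign \<pi>) * (coframe e (\<pi> 4) y * coframe e (\<pi> 5) z - coframe e (\<pi> 5) y * coframe e (\<pi> 4) z)"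
proof -
  let ?xs = "[e (\<pi> 1), e (\<pi> 2), e (\<pi> 3), y, z]"
  let ?s = "Transposition.transpose 4 (5::nat)"
  let ?t = "\<lambda>p. of_int (sign p) * (\<Prod>i=1..5. coframe e (p i) (?xs ! (i - 1)))"
  have prod: "(\<Prod>i=1..5. coframe e (p i) (?xs ! (i - 1)))
      = coframe e (p 1) (e (\<pi> 1)) * coframe e (p 2) (e (\<pi> 2))
      * coframe e (p 3) (e (\<pi> 3)) * coframe e (p 4) y * coframe e (p 5) z" for p
    by (simp add: atLeastAtMost_1_5 numeral_eq_Suc One_nat_def)
  have in5: "p i \<in> {1..5}" if "p permutes {1..5}" "i \<in> {1..5}" for p i
    using permutes_in_image[OF that(1)] that(2) by blast
  have s: "?s permutes {1..5}" by (rule permutes_swap_id) auto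
  have \<pi>s: "\<pi> \<circ> ?s permutes {1..5}" by (rule permutes_compose[OF s \<pi>])
  have zero: "?t p = 0" if "p permutes {1..5}" "p \<notin> {\<pi>, \<pi> \<circ> ?s}" for p
  proof (rule ccontr)
    assume "?t p \<noteq> 0"
    then have eq: "p 1 = \<pi> 1" "p 2 = \<pi> 2" "p 3 = \<pi> 3"
      using in5[OF that(1)] in5[OF \<pi>] by (auto simp: prod coframe_basis[OF fr] split: if_splits)
    have inj: "inj p" "inj \<pi>" using that(1) \<pi> permutes_inj by blast+
    have "\<forall>i\<in>{4, 5}. p i \<in> {\<pi> 4, \<pi> 5}"
    proof
      fix i :: nat assume i: "i \<in> {4, 5}"
      then have "p i \<in> \<pi> ` {1..5}" using in5[OF that(1), of i] permutes_image[OF \<pi>] by auto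
      then show "p i \<in> {\<pi> 4, \<pi> 5}"
        using i eq injD[OF inj(1), of i 1] injD[OF inj(1), of i 2] injD[OF inj(1), of i 3]
        by (auto simp: atLeastAtMost_1_5)
    qed
    then have "p 4 = \<pi> 4 \<and> p 5 = \<pi> 5 \<or> p 4 = \<pi> 5 \<and> p 5 = \<pi> 4"
      using injD[OF inj(1), of 4 5] by auto
    moreover have "p i = \<pi> i \<and> ?s i = i" if "i \<notin> {1..5}" for i
      using that permutes_not_in[OF \<open>p permutes _\<close>] permutes_not_in[OF \<pi>]
      by (auto simp: Transposition.transpose_def)
    ultimately have "(\<forall>i. p i = \<pi> i) \<or> (\<forall>i. p i = \<pi> (?s i))"
      using eq by (auto simp: atLeastAtMost_1_5 Transposition.transpose_def) metis+
    then show False using that(2) by (auto simp: fun_eq_iff)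
  qed
  have "vol e ?xs = sum ?t {\<pi>, \<pi> \<circ> ?s}"
    unfolding vol_def using \<pi> \<pi>s zero
    by (intro sum.mono_neutral_right) (auto intro: finite_permutations)
  also have "\<dots> = ?t \<pi> + ?t (\<pi> \<circ> ?s)"
  proof -
    have "\<pi> 4 \<noteq> \<pi> 5" using injD[OF permutes_inj[OF \<pi>], of 4 5] by auto
    then have "\<pi> \<noteq> \<pi> \<circ> ?s" by (metis comp_apply transpose_apply_first)
    then show ?thesis by simp
  qed
  also have "sign (\<pi> \<circ> ?s) = - sign \<pi>"
    using \<pi> by (simp add: sign_compose permutation_permutes[THEN iffD2, OF exI[of _ "{1..5}"]]
        permutation_swap_id sign_swap_id)
  finally show ?thesis
    using in5[OF \<pi>] by (simp add: prod coframe_basis[OF fr] Transposition.transpose_def algebra_simps)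
qed

lemma sum_three_subsets:
  fixes F :: "nat set \<Rightarrow> 'b::comm_monoid_add"
  shows "(\<Sum>I | I \<subseteq> {1..5} \<and> card I = 3. F I) = F {1,2,3} + F {1,2,4} + F {1,2,5} + F {1,3,4} + F {1,3,5}
    + F {1,4,5} + F {2,3,4} + F {2,3,5} + F {2,4,5} + F {3,4,5}"
proof -
  let ?L = "[{1,2,3}, {1,2,4}, {1,2,5}, {1,3,4}, {1,3,5}, {1,4,5}, {2,3,4}, {2,3,5}, {2,4,5}, {3,4,5::nat}]"
  have "Set.filter (\<lambda>I. card I = 3) (Pow (set [1,2,3,4,5::nat])) = set ?L" and d: "distinct ?L"
    by code_simp+
  then have "{I. I \<subseteq> {1..5::nat} \<and> card I = 3} = set ?L"
    by (auto simp: atLeastAtMost_1_5)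
  then show ?thesis using sum.distinct_set_conv_list[OF d, of F] by (simp add: add.assoc)
qed

text \<open>Each increasing triple is paired with the 2x2 minor of the complementary indices; the
  sign is that of the permutation listing the triple and then its complement.\<close>

lemma hodge_3:
  assumes fr: "frame e"
  defines "m \<equiv> \<lambda>i j y z. coframe e i y * coframe e j z - coframe e j y * coframe e i z"
  shows "hodge e 3 (form3 t) [y, z] =
    t (e 1) (e 2) (e 3) * m 4 5 y z - t (e 1) (e 2) (e 4) * m 3 5 y z + t (e 1) (e 2) (e 5) * m 3 4 y z
    + t (e 1) (e 3) (e 4) * m 2 5 y z - t (e 1) (e 3) (e 5) * m 2 4 y z
        + t (e 1) (e 4) (e 5) * m 2 3 y z
    - t (e 2) (e 3) (e 4) * m 1 5 y z + t (e 2) (e 3) (e 5) * m 1 4 y z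
        - t (e 2) (e 4) (e 5) * m 1 3 y z
    + t (e 3) (e 4) (e 5) * m 1 2 y z"
proof -
  let ?tr = "Transposition.transpose :: nat \<Rightarrow> _"
  \<comment> \<open>Iterating this gives the signs of products of up to four transpositions.\<close>
  have comp: "p \<circ> ?tr a b permutes {1..5} \<and> sign (p \<circ> ?tr a b) = - \<sigma>"
    if "p permutes {1..5} \<and> sign p = \<sigma>" "a \<in> {1..5}" "b \<in> {1..5}" "a \<noteq> b" for p a b \<sigma>
    using that permutes_compose[OF permutes_swap_id[OF that(2,3)], of p]
    by (simp add: sign_compose permutation_swap_id sign_swap_id
        permutation_permutes[THEN iffD2, OF exI[of _ "{1..5}"]])
  note c1 = comp[OF conjI[OF permutes_id sign_id]]
  note c2 = comp[OF c1]
  note c3 = comp[OF c2]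
  note c4 = comp[OF c3]
  have sorted: "sorted_list_of_set {1,2,3::nat} = [1,2,3]" "sorted_list_of_set {1,2,4::nat} = [1,2,4]"
    "sorted_list_of_set {1,2,5::nat} = [1,2,5]" "sorted_list_of_set {1,3,4::nat} = [1,3,4]"
    "sorted_list_of_set {1,3,5::nat} = [1,3,5]" "sorted_list_of_set {1,4,5::nat} = [1,4,5]"
    "sorted_list_of_set {2,3,4::nat} = [2,3,4]" "sorted_list_of_set {2,3,5::nat} = [2,3,5]"
    "sorted_list_of_set {2,4,5::nat} = [2,4,5]" "sorted_list_of_set {3,4,5::nat} = [3,4,5]"
    by simp_all
  note V = vol_three_frame_vectors[OF fr]
  have vols:
    "vol e [e 1, e 2, e 3, y, z] = m 4 5 y z"
    "vol e [e 1, e 2, e 4, y, z] = - m 3 5 y z"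
    "vol e [e 1, e 2, e 5, y, z] = m 3 4 y z"
    "vol e [e 1, e 3, e 4, y, z] = m 2 5 y z"
    "vol e [e 1, e 3, e 5, y, z] = - m 2 4 y z"
    "vol e [e 1, e 4, e 5, y, z] = m 2 3 y z"
    "vol e [e 2, e 3, e 4, y, z] = - m 1 5 y z"
    "vol e [e 2, e 3, e 5, y, z] = m 1 4 y z"
    "vol e [e 2, e 4, e 5, y, z] = - m 1 3 y z"
    "vol e [e 3, e 4, e 5, y, z] = m 1 2 y z"
    \<comment> \<open>Each product of transpositions below lists the triple in increasing order,
      then the remaining two indices in increasing order.\<close>
    subgoal using V[OF permutes_id, of y z] by (simp add: m_def)
    subgoal using V[of "id \<circ> ?tr 3 4" y z] c1[of 3 4] by (simp add: m_def Transposition.transpose_def)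
    subgoal using V[of "id \<circ> ?tr 3 4 \<circ> ?tr 3 5" y z] c2[of 3 4 3 5]
        by (simp add: m_def Transposition.transpose_def)
    subgoal using V[of "id \<circ> ?tr 2 3 \<circ> ?tr 3 4" y z] c2[of 2 3 3 4]
        by (simp add: m_def Transposition.transpose_def)
    subgoal using V[of "id \<circ> ?tr 2 3 \<circ> ?tr 3 4 \<circ> ?tr 3 5" y z] c3[of 2 3 3 4 3 5]
        by (simp add: m_def Transposition.transpose_def)
    subgoal using V[of "id \<circ> ?tr 2 4 \<circ> ?tr 3 5" y z] c2[of 2 4 3 5]
        by (simp add: m_def Transposition.transpose_def)
    subgoal using V[of "id \<circ> ?tr 1 2 \<circ> ?tr 2 3 \<circ> ?tr 3 4" y z] c3[of 1 2 2 3 3 4]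
        by (simp add: m_def Transposition.transpose_def)
    subgoal using V[of "id \<circ> ?tr 1 2 \<circ> ?tr 2 3 \<circ> ?tr 3 4 \<circ> ?tr 3 5" y z] c4[of 1 2 2 3 3 4 3 5]
        by (simp add: m_def Transposition.transpose_def)
    subgoal using V[of "id \<circ> ?tr 1 2 \<circ> ?tr 2 4 \<circ> ?tr 3 5" y z] c3[of 1 2 2 4 3 5]
        by (simp add: m_def Transposition.transpose_def)
    subgoal using V[of "id \<circ> ?tr 1 3 \<circ> ?tr 2 4 \<circ> ?tr 3 5 \<circ> ?tr 4 5" y z] c4[of 1 3 2 4 3 5 4 5]
        by (simp add: m_def Transposition.transpose_def)
    done
  show ?thesis
    by (simp add: hodge_def sum_three_subsets sorted form3_def vols Let_def)
qed

section \<open>Bi-invariant metrics in dimension 5\<close>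

lemma bilinear_span_mem:
  assumes b: "bilinear br" and C: "subspace C" and AB: "\<And>x y. x \<in> A \<Longrightarrow> y \<in> B \<Longrightarrow> br x y \<in> C"
    and "x \<in> span A" "y \<in> span B"
  shows "br x y \<in> C"
proof -
  have lin: "linear (br x)" "linear (\<lambda>x. br x y)" for x y using b by (simp_all add: bilinear_def)
  have "br x y \<in> C" if "x \<in> A" "y \<in> span B" for x y
  proof -
    have "span B \<subseteq> br x -` C"
      using AB[OF that(1)] by (intro span_minimal linear_subspace_vimage[OF lin(1) C]) auto
    then show ?thesis using that(2) by auto
  qed
  then have "A \<subseteq> (\<lambda>x. br x y) -` C" using assms(5) by auto
  then have "span A \<subseteq> (\<lambda>x. br x y) -` C"
    by (rule span_minimal) (rule linear_subspace_vimage[OF lin(2) C])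
  then show ?thesis using assms(4) by auto
qed

text \<open>
  In dimension 5 the Jacobi identity of a bi-invariant bracket is the system of Pluecker
  relations of the 2-form dual to the 3-form \<open>C\<close>, so \<open>C\<close> is decomposable. The exchange relation
  expresses this.
\<close>

lemma exchange_relation:
  fixes C :: "nat \<Rightarrow> nat \<Rightarrow> nat \<Rightarrow> real"
  assumes sk: "\<And>i j k. C j i k = - C i j k" "\<And>i j k. C i k j = - C i j k"
    and jac: "\<And>i j k l. \<lbrakk>i \<in> {1..5}; j \<in> {1..5}; k \<in> {1..5}; l \<in> {1..5}\<rbrakk> \<Longrightarrow>
      (\<Sum>m = 1..5. C i j m * C k l m + C j k m * C i l m + C k i m * C j l m) = 0"
    and mem: "a \<in> {1..5}" "b \<in> {1..5}" "c \<in> {1..5}" "x \<in> {1..5}" "y \<in> {1..5}" "z \<in> {1..5}"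
  shows "C a b c * C x y z = C x b c * C a y z + C a x c * C b y z + C a b x * C c y z"
proof -
  have same: "C i i k = 0" "C i k k = 0" "C i k i = 0" for i k
    using sk(1)[of i i k] sk(2)[of i k k] sk(1)[of i k i] sk(2)[of i i k] by auto
  have perm: "C j i k = - C i j k" "C i k j = - C i j k" "C j k i = C i j k" "C k i j = C i j k"
      "C k j i = - C i j k"
    for i j k
    using sk(1)[of i j k] sk(2)[of i j k] sk(1)[of i k j] sk(2)[of j i k] sk(1)[of j k i]
      sk(2)[of k i j] by auto
  show ?thesis
  proof (cases "distinct [a, b, c, x]")
    \<comment> \<open>With a repeated index among \<open>a\<close>, \<open>b\<close>,
      \<open>c\<close>, \<open>x\<close> the relation is a consequence of skewness.\<close>
    case False
    then consider "a = b" | "a = c" | "a = x" | "b = c" | "b = x" | "c = x" by auto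
    then show ?thesis
    proof cases
      case 1
      then show ?thesis using sk(1)[where i = a and j = x and k = c] by (simp add: same)
    next
      case 2
      then show ?thesis using perm(5)[where i = a and j = b and k = x] by (simp add: same)
    next
      case 4
      then show ?thesis using sk(2)[where i = a and j = b and k = x] by (simp add: same)
    qed (simp_all add: same)
  next
    case True
    have "card ({1..5} - {a, b, c, x}) = 1"
      using True mem by (subst card_Diff_subset) auto
    then obtain f where eq: "{1..5} - {a, b, c, x} = {f}" by (rule card_1_singletonE)
    have "f \<in> {1..5} - {a, b, c, x}" unfolding eq by simp
    then have f: "f \<noteq> a" "f \<noteq> b" "f \<noteq> c" "f \<noteq> x" "f \<in> {1..5}" by blast+
    have U: "{1..5} = {a, b, c, x, f}" using eq mem by blast
    have S: "(\<Sum>m = 1..5. g m) = g a + g b + g c + g x + g f" for g :: "nat \<Rightarrow> real"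
      unfolding U using True f by (simp add: add.assoc)
    note P =
      perm[where i = a and j = b and k = c] perm[where i = a and j = b and k = x]
      perm[where i = a and j = b and k = f] perm[where i = a and j = c and k = x]
      perm[where i = a and j = c and k = f] perm[where i = a and j = x and k = f]
      perm[where i = b and j = c and k = x] perm[where i = b and j = c and k = f]
      perm[where i = b and j = x and k = f] perm[where i = c and j = x and k = f]
    \<comment> \<open>For four distinct indices the sum over \<open>m\<close> retains only the fifth
      index, so each Jacobi identity is a three-term Pluecker relation. \<open>J1\<close> to
      \<open>J5\<close> omit \<open>f\<close>, \<open>x\<close>, \<open>c\<close>, \<open>b\<close>,
      \<open>a\<close> in turn.\<close>
    have J1: "C a b f * C c x f - C a c f * C b x f + C a x f * C b c f = 0"
      using jac[OF mem(1,2,3,4), unfolded S, unfolded P same] by (simp add: mult.commute)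
    have J2: "C a b x * C c x f - C a c x * C b x f + C b c x * C a x f = 0"
      using jac[OF mem(1,2,3) f(5), unfolded S, unfolded P same] by (simp add: mult.commute)
    have J3: "C a b c * C c x f - C a c x * C b c f + C b c x * C a c f = 0"
      using jac[OF mem(1,2,4) f(5), unfolded S, unfolded P same] by (simp add: mult.commute)
    have J4: "C a b c * C b x f - C a b x * C b c f + C b c x * C a b f = 0"
      using jac[OF mem(1,3,4) f(5), unfolded S, unfolded P same] by (simp add: mult.commute)
    have J5: "C a b c * C a x f - C a b x * C a c f + C a c x * C a b f = 0"
      using jac[OF mem(2,3,4) f(5), unfolded S, unfolded P same] by (simp add: mult.commute)
    note J = J1 J2 J3 J4 J5
    have "y \<in> {a, b, c, x, f}" "z \<in> {a, b, c, x, f}" using mem(5,6) unfolding U .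
    then show ?thesis
      by (elim insertE emptyE;
          simp only: P same mult_zero_left mult_zero_right mult_minus_left mult_minus_right;
          use J in \<open>simp add: mult.commute\<close>)
  qed
qed

locale biinvariant =
  fixes br :: "'a::real_vector \<Rightarrow> 'a \<Rightarrow> 'a" and e :: "nat \<Rightarrow> 'a"
  assumes lie: "lie_algebra br" and fr: "frame e"
    and invariant: "totally_skew (\<lambda>x y z. frame_metric e (br x y) z)"
begin

abbreviation g where "g \<equiv> frame_metric e"

lemma bilin: "bilinear br" "bilinear g"
  using lie frame_metric_bilinear[OF fr] by (simp_all add: lie_algebra_def)

lemma g_skew: "g (br y x) z = - g (br x y) z" "g (br x z) y = - g (br x y) z"
  using invariant unfolding totally_skew_def by blast+

lemma g_cyclic: "g (br y z) x = g (br x y) z"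
  using g_skew(1)[of y x z] g_skew(2)[of y x z] by simp

text \<open>Invariance moves the outer bracket to the other argument of \<open>g\<close>, which
  turns the Jacobi identity into one quadratic in brackets. Closedness and the exchange relation
  both rest on this form.\<close>

lemma jacobi: "g (br x y) (br z u) + g (br y z) (br x u) + g (br z x) (br y u) = 0"
proof -
  have "br x (br y z) + br y (br z x) + br z (br x y) = 0"
    using lie by (simp add: lie_algebra_def)
  then have "g (br x (br y z) + br y (br z x) + br z (br x y)) u = 0"
    by (simp add: bilinear_lzero[OF bilin(2)])
  then have "g (br u x) (br y z) + g (br u y) (br z x) + g (br u z) (br x y) = 0"
    by (simp only: bilinear_ladd[OF bilin(2)] g_cyclic[of _ _ u])
  moreover have "g v (br w u) = - g (br u w) v" for v w
    unfolding frame_metric_sym[of e v] by (rule g_skew)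
  ultimately show ?thesis by simp
qed

text \<open>The six terms of the derivative become \<open>g (br a b) (br c d)\<close> and agree in
  pairs, giving minus twice the left side of \<open>jacobi\<close>.\<close>

lemma closed_3: "closed_form br 3 (form3 (\<lambda>x y z. g (br x y) z))"
  unfolding closed_form_def
proof (intro allI impI)
  fix xs :: "'a list" assume "length xs = 3 + 1"
  then obtain x y z u where xs: "xs = [x, y, z, u]" by
    (auto simp: length_Suc_conv numeral_eq_Suc One_nat_def)
  have 1: "g (br (br a b) c) d = g (br a b) (br c d)" for a b c d
    unfolding frame_metric_sym[of e "br a b" "br c d"] by (rule g_cyclic[symmetric])
  have 2: "g (br y z) (br x u) = g (br x u) (br y z)" "g (br z x) (br y u) = - g (br x z) (br y u)"
    "g (br y u) (br x z) = g (br x z) (br y u)" "g (br z u) (br x y) = g (br x y) (br z u)"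
    by (rule frame_metric_sym g_skew)+
  show "ext_deriv br (form3 (\<lambda>x y z. g (br x y) z)) xs = 0"
    using jacobi[of x y z u] by (simp add: xs ext_deriv_3 form3_def 1 2)
qed

definition C :: "nat \<Rightarrow> nat \<Rightarrow> nat \<Rightarrow> real" where
  "C i j k = g (br (e i) (e j)) (e k)"

lemma C_skew: "C j i k = - C i j k" "C i k j = - C i j k"
  unfolding C_def by (rule g_skew)+

lemma C_same: "C i i k = 0" "C i k k = 0" "C i k i = 0"
  using C_skew(1)[of i i k] C_skew(2)[of i k k] C_skew(1)[of i k i] C_skew(2)[of i i k] by auto

lemma br_frame: "br (e i) (e j) = (\<Sum>k=1..5. C i j k *\<^sub>R e k)"
proof -
  have "(\<Sum>k=1..5. C i j k *\<^sub>R e k) = (\<Sum>k=1..5. coframe e k (br (e i) (e j)) *\<^sub>R e k)"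
    by (rule sum.cong) (simp_all add: C_def frame_metric_basis[OF fr])
  then show ?thesis using frame_expansion[OF fr] by simp
qed

lemma C_exchange:
  assumes "a \<in> {1..5}" "b \<in> {1..5}" "c \<in> {1..5}" "x \<in> {1..5}" "y \<in> {1..5}"
      "z \<in> {1..5}"
  shows "C a b c * C x y z = C x b c * C a y z + C a x c * C b y z + C a b x * C c y z"
proof (rule exchange_relation[OF C_skew _ assms])
  fix i j k l
  have 1: "g (br (e i) (e j)) (br (e k) (e l)) = (\<Sum>m=1..5. C i j m * C k l m)" for i j k l
    unfolding frame_metric_def[of e "br (e i) (e j)"]
    by (rule sum.cong) (simp_all add: C_def frame_metric_basis[OF fr])
  show "(\<Sum>m = 1..5. C i j m * C k l m + C j k m * C i l m + C k i m * C j l m) = 0"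
    using jacobi[of "e i" "e j" "e k" "e l"] by (simp add: 1 sum.distrib)
qed

text \<open>Multiplying \<open>C_exchange\<close> by \<open>e z\<close> and summing over
  \<open>z\<close> yields this vector form.\<close>

lemma br_exchange:
  assumes "a \<in> {1..5}" "b \<in> {1..5}" "c \<in> {1..5}" "x \<in> {1..5}" "y \<in> {1..5}"
  shows "C a b c *\<^sub>R br (e x) (e y)
    = C x b c *\<^sub>R br (e a) (e y) + C a x c *\<^sub>R br (e b) (e y) + C a b x *\<^sub>R br (e c) (e y)"
  unfolding br_frame scaleR_sum_right scaleR_scaleR sum.distrib[symmetric]
      scaleR_left_distrib[symmetric]
  by (rule sum.cong[OF refl]) (simp only: C_exchange[OF assms])

lemma span_frame: "span (e ` {1..5}) = UNIV"
  using fr unfolding frame_def by blast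

section \<open>The commutator algebra\<close>

lemma commutator_subset:
  assumes "subspace S" "\<And>i j. i \<in> {1..5} \<Longrightarrow> j \<in> {1..5} \<Longrightarrow> br (e i) (e j) \<in> S"
  shows "bracket_span br UNIV UNIV \<subseteq> S"
proof -
  have "br x y \<in> S" for x y
    by (rule bilinear_span_mem[OF bilin(1) assms(1), of "e ` {1..5}" "e ` {1..5}"])
      (use assms(2) in blast, simp_all only: span_frame UNIV_I)
  then show ?thesis unfolding bracket_span_def by (intro span_minimal assms(1)) auto
qed

text \<open>The exchange relation moves the first index of a bracket into \<open>{a, b, c}\<close>;
  skewness and a second exchange do the same for the other index. So the three brackets among
  \<open>e a\<close>, \<open>e b\<close>, \<open>e c\<close> span, and pairing them with the frame
  shows independence.\<close>

lemma dim_commutator: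
  assumes ne: "C a b c \<noteq> 0" and mem: "a \<in> {1..5}" "b \<in> {1..5}" "c \<in> {1..5}"
  shows "dim (bracket_span br UNIV UNIV) = 3"
proof -
  let ?B = "{br (e b) (e c), br (e c) (e a), br (e a) (e b)}"
  have sk: "br x y = - br y x" for x y by (rule lie_algebra_skew[OF lie])
  have same: "br x x = 0" for x using lie by (simp add: lie_algebra_def)
  have sub: "br (e x) (e y) \<in> span ?B" if x: "x \<in> {1..5}" and y: "y \<in> {1..5}"
    and "br (e a) (e y) \<in> span ?B" "br (e b) (e y) \<in> span ?B" "br (e c) (e y) \<in> span ?B" for x y
  proof -
    have "C a b c *\<^sub>R br (e x) (e y) \<in> span ?B"
      unfolding br_exchange[OF mem x y] using that by (intro span_add span_scale)
    then have "inverse (C a b c) *\<^sub>R (C a b c *\<^sub>R br (e x) (e y)) \<in> span ?B"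
      by (rule span_scale)
    then show ?thesis using ne by simp
  qed
  have v: "br (e b) (e c) \<in> span ?B" "br (e c) (e a) \<in> span ?B" "br (e a) (e b) \<in> span ?B"
    by (rule span_base; simp)+
  have "br (e c) (e b) \<in> span ?B" "br (e a) (e c) \<in> span ?B" "br (e b) (e a) \<in> span ?B"
    using v[THEN span_neg] unfolding sk[symmetric] by blast+
  with v have base: "br (e x) (e y) \<in> span ?B" if "x \<in> {a, b, c}" "y \<in> {a, b, c}" for x y
    using that by (elim insertE emptyE) (simp_all only: same span_zero)
  have "br (e x) (e y) \<in> span ?B" if x: "x \<in> {1..5}" and y: "y \<in> {a, b, c}" for x y
  proof (rule sub[OF x])
    show "y \<in> {1..5}" using y mem by blast
  qed (rule base; use y in blast)+
  then have "br (e y) (e x) \<in> span ?B" if "x \<in> {1..5}" "y \<in> {a, b, c}" for x y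
    unfolding sk[of "e y" "e x"] using that by (intro span_neg) blast
  then have "br (e x) (e y) \<in> span ?B" if "x \<in> {1..5}" "y \<in> {1..5}" for x y
    using sub[OF that] that by blast
  then have "bracket_span br UNIV UNIV \<subseteq> span ?B" by (intro commutator_subset subspace_span)
  moreover have "span ?B \<subseteq> bracket_span br UNIV UNIV"
    unfolding bracket_span_def by (rule span_mono) blast
  ultimately have eq: "bracket_span br UNIV UNIV = span ?B" by auto
  have lin: "linear (\<lambda>x. g x v)" for v using bilin(2) by (simp add: bilinear_def)
  have cyc: "C b c a = C a b c" "C c a b = C a b c"
    using C_skew(1)[of b a c] C_skew(2)[of b c a] C_skew(1)[of a c b] C_skew(2)[of a b c] by auto
  \<comment> \<open>Triangular independence: the component along \<open>e a\<close> is zero on the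
    last two brackets but equals \<open>C a b c\<close> on the first; then the same with
    \<open>e b\<close>.\<close>
  have "g v (e a) = 0" if "v \<in> span {br (e c) (e a), br (e a) (e b)}" for v
    by (rule linear_eq_0_on_span[OF lin _ that]) (auto simp: C_def[symmetric] C_same)
  then have n1: "br (e b) (e c) \<notin> span {br (e c) (e a), br (e a) (e b)}"
    using ne cyc by (auto simp: C_def)
  have "g v (e b) = 0" if "v \<in> span {br (e a) (e b)}" for v
    by (rule linear_eq_0_on_span[OF lin _ that]) (auto simp: C_def[symmetric] C_same)
  then have n2: "br (e c) (e a) \<notin> span {br (e a) (e b)}"
    using ne cyc by (auto simp: C_def)
  have n3: "br (e a) (e b) \<noteq> 0"
    using ne by (auto simp: C_def bilinear_lzero[OF bilin(2)])
  have "independent ?B"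
    using n1 n2 n3 by (simp add: independent_insert independent_empty)
  moreover have "br (e b) (e c) \<notin> {br (e c) (e a), br (e a) (e b)}" "br (e c) (e a) \<notin> {br (e a) (e b)}"
    using n1 n2 by (meson span_base)+
  then have "card ?B = 3" by simp
  ultimately show ?thesis unfolding eq using real_vector.dim_span_eq_card_independent[of ?B]
      by presburger
qed

text \<open>Multiplying \<open>br_exchange\<close> by \<open>C a b c\<close> and summing over all
  frame indices gives \<open>M\<close> times \<open>br (e x) (e y)\<close> as
  \<open>br (v x) (e y)\<close>, where \<open>v x\<close> is a commutator and \<open>M\<close> is a
  nonzero sum of squares. Doing this in both arguments writes \<open>M^2\<close> times a bracket as
  \<open>br (v i) (v j)\<close>.\<close>

lemma commutator_perfect:
  assumes ne: "C a b c \<noteq> 0" and mem: "a \<in> {1..5}" "b \<in> {1..5}" "c \<in> {1..5}"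
  defines "l \<equiv> bracket_span br UNIV UNIV"
  shows "l = bracket_span br l l"
proof -
  let ?I = "{1..5::nat}"
  define M where "M = (\<Sum>a\<in>?I. \<Sum>b\<in>?I. \<Sum>c\<in>?I. (C a b c)\<^sup>2)"
  have "M \<noteq> 0"
  proof
    assume "M = 0"
    then have "(C a b c)\<^sup>2 = 0"
      using mem unfolding M_def
      by (simp add: sum_nonneg_eq_0_iff sum_nonneg)
    then show False using ne by simp
  qed
  \<comment> \<open>The factor 3 accounts for the three terms of the exchange relation, whose sums
    turn out equal.\<close>
  define v where "v x = 3 *\<^sub>R (\<Sum>b\<in>?I. \<Sum>c\<in>?I. C x b c *\<^sub>R br (e b) (e c))" for x
  have three: "w + w + w = 3 *\<^sub>R w" for w :: 'a
    using scaleR_left_distrib[of 2 1 w] by (simp add: scaleR_2)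
  have v_mem: "v x \<in> l" for x
    unfolding v_def l_def bracket_span_def
    by (intro span_scale span_sum span_base) blast
  have basis: "M *\<^sub>R br (e x) (e y) = br (v x) (e y)" if x: "x \<in> ?I" and y: "y \<in> ?I" for x y
  proof -
    have "M *\<^sub>R br (e x) (e y) = (\<Sum>a\<in>?I. \<Sum>b\<in>?I. \<Sum>c\<in>?I. C a b c *\<^sub>R (C a b c *\<^sub>R br (e x) (e y)))"
      by (simp add: M_def scaleR_sum_left power2_eq_square)
    also have "\<dots> = (\<Sum>a\<in>?I. \<Sum>b\<in>?I. \<Sum>c\<in>?I. C a b c *\<^sub>R (C x b c *\<^sub>R br (e a) (e y)
        + C a x c *\<^sub>R br (e b) (e y) + C a b x *\<^sub>R br (e c) (e y)))"
      by (intro sum.cong refl arg_cong2[where f = scaleR] br_exchange x y)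
    also have "\<dots> = (\<Sum>a\<in>?I. \<Sum>b\<in>?I. \<Sum>c\<in>?I. (C x b c * C a b c) *\<^sub>R br (e a) (e y))
        + (\<Sum>a\<in>?I. \<Sum>b\<in>?I. \<Sum>c\<in>?I. (C x a c * C b a c) *\<^sub>R br (e b) (e y))
        + (\<Sum>a\<in>?I. \<Sum>b\<in>?I. \<Sum>c\<in>?I. (C x a b * C c a b) *\<^sub>R br (e c) (e y))"
    proof -
      have "C a b c *\<^sub>R (C x b c *\<^sub>R br (e a) (e y) + C a x c *\<^sub>R br (e b) (e y)
          + C a b x *\<^sub>R br (e c) (e y))
        = (C x b c * C a b c) *\<^sub>R br (e a) (e y) + (C x a c * C b a c) *\<^sub>R br (e b) (e y)
          + (C x a b * C c a b) *\<^sub>R br (e c) (e y)" for a b c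
        using C_skew(1)[of x a c] C_skew(1)[of a b c] C_skew(1)[of a x b] C_skew(2)[of a x b]
          C_skew(1)[of a c b] C_skew(2)[of a c b]
        by (simp add: scaleR_add_right mult.commute)
      then show ?thesis by (simp add: sum.distrib)
    qed
    \<comment> \<open>Renaming summation indices brings the second and third sums to the shape of
      the first.\<close>
    also have "(\<Sum>a\<in>?I. \<Sum>b\<in>?I. \<Sum>c\<in>?I. (C x a c * C b a c) *\<^sub>R br (e b) (e y))
        = (\<Sum>a\<in>?I. \<Sum>b\<in>?I. \<Sum>c\<in>?I. (C x b c * C a b c) *\<^sub>R br (e a) (e y))"
      by (rule sum.swap)
    also have "(\<Sum>a\<in>?I. \<Sum>b\<in>?I. \<Sum>c\<in>?I. (C x a b * C c a b) *\<^sub>R br (e c) (e y))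
        = (\<Sum>a\<in>?I. \<Sum>c\<in>?I. \<Sum>b\<in>?I. (C x a b * C c a b) *\<^sub>R br (e c) (e y))"
      by (intro sum.cong refl sum.swap)
    also have "\<dots> = (\<Sum>a\<in>?I. \<Sum>b\<in>?I. \<Sum>c\<in>?I. (C x b c * C a b c) *\<^sub>R br (e a) (e y))"
      by (rule sum.swap)
    also have "(\<Sum>a\<in>?I. \<Sum>b\<in>?I. \<Sum>c\<in>?I. (C x b c * C a b c) *\<^sub>R br (e a) (e y))
        = (\<Sum>a\<in>?I. \<Sum>b\<in>?I. \<Sum>c\<in>?I. C x b c *\<^sub>R (C b c a *\<^sub>R br (e a) (e y)))"
    proof -
      have "(C x b c * C a b c) *\<^sub>R br (e a) (e y) = C x b c *\<^sub>R (C b c a *\<^sub>R br (e a) (e y))" for a b c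
        using C_skew(1)[of b a c] C_skew(2)[of b c a] by simp
      then show ?thesis by (simp only:)
    qed
    also have "\<dots> = (\<Sum>b\<in>?I. \<Sum>a\<in>?I. \<Sum>c\<in>?I. C x b c *\<^sub>R (C b c a *\<^sub>R br (e a) (e y)))"
      by (rule sum.swap)
    also have "\<dots> = (\<Sum>b\<in>?I. \<Sum>c\<in>?I. \<Sum>a\<in>?I. C x b c *\<^sub>R (C b c a *\<^sub>R br (e a) (e y)))"
      by (intro sum.cong refl sum.swap)
    also have "\<dots> = br (\<Sum>b\<in>?I. \<Sum>c\<in>?I. C x b c *\<^sub>R br (e b) (e c)) (e y)"
    proof -
      have lin: "linear (\<lambda>x. br x (e y))" using bilin(1) by (simp add: bilinear_def)
      have "br (br (e b) (e c)) (e y) = (\<Sum>a\<in>?I. C b c a *\<^sub>R br (e a) (e y))" for b c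
        unfolding br_frame[of b c] by (simp only: linear_sum[OF lin] linear_scale[OF lin])
      then show ?thesis by (simp add: linear_sum[OF lin] linear_scale[OF lin] scaleR_sum_right)
    qed
    finally show ?thesis
      by (simp only: v_def bilinear_lmul[OF bilin(1)] three)
  qed
  \<comment> \<open>An arbitrary second argument is allowed so that the relation can be applied
    again with \<open>w = v i\<close>.\<close>
  have general: "M *\<^sub>R br (e x) w = br (v x) w" if "x \<in> ?I" for x w
  proof (rule linear_eq_on[of "\<lambda>w. M *\<^sub>R br (e x) w" "br (v x)" w "e ` ?I"])
    show "linear (\<lambda>w. M *\<^sub>R br (e x) w)" "linear (br (v x))"
      using bilin(1) by (auto simp: bilinear_def intro: linear_compose_scale_right)
  qed (use basis that span_frame in auto)
  have sk: "br x y = - br y x" for x y by (rule lie_algebra_skew[OF lie])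
  have "br (e i) (e j) \<in> bracket_span br l l" if i: "i \<in> ?I" and j: "j \<in> ?I" for i j
  proof -
    have "M *\<^sub>R (M *\<^sub>R br (e i) (e j)) = - (M *\<^sub>R br (e j) (v i))"
      using general[OF i, of "e j"] sk[of "v i" "e j"] by simp
    also have "\<dots> = br (v i) (v j)" using general[OF j, of "v i"] sk[of "v i" "v j"] by simp
    also have "\<dots> \<in> bracket_span br l l"
      unfolding bracket_span_def using v_mem by (intro span_base) blast
    finally have mem: "M *\<^sub>R (M *\<^sub>R br (e i) (e j)) \<in> bracket_span br l l" .
    have "br (e i) (e j) = inverse M *\<^sub>R (inverse M *\<^sub>R (M *\<^sub>R (M *\<^sub>R br (e i) (e j))))"
    proof -
      have "inverse M * (inverse M * (M * M)) = 1" using \<open>M \<noteq> 0\<close> by (simp add: field_simps)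
      then show ?thesis by simp
    qed
    also have "\<dots> \<in> bracket_span br l l"
      using mem unfolding bracket_span_def by (rule span_scale[OF span_scale])
    finally show ?thesis .
  qed
  then have "l \<subseteq> bracket_span br l l"
    unfolding l_def[symmetric] using commutator_subset[of "bracket_span br l l"]
    by (simp add: l_def bracket_span_def)
  moreover have "bracket_span br l l \<subseteq> l"
    unfolding l_def bracket_span_def[of br UNIV UNIV] bracket_span_def[of br "span _"]
        by (rule span_mono) blast
  ultimately show ?thesis by blast
qed

section \<open>Coclosedness of the 3-form\<close>

lemma C_sort:
  shows "C 2 3 1 = C 1 2 3" "C 1 3 2 = - C 1 2 3" "C 2 4 1 = C 1 2 4" "C 1 4 2 = - C 1 2 4"
    "C 2 5 1 = C 1 2 5" "C 1 5 2 = - C 1 2 5" "C 3 4 1 = C 1 3 4" "C 1 4 3 = - C 1 3 4"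
    "C 3 5 1 = C 1 3 5" "C 1 5 3 = - C 1 3 5" "C 4 5 1 = C 1 4 5" "C 1 5 4 = - C 1 4 5"
    "C 3 4 2 = C 2 3 4" "C 2 4 3 = - C 2 3 4" "C 3 5 2 = C 2 3 5" "C 2 5 3 = - C 2 3 5"
    "C 4 5 2 = C 2 4 5" "C 2 5 4 = - C 2 4 5" "C 4 5 3 = C 3 4 5" "C 3 5 4 = - C 3 4 5"
  by (metis C_skew minus_minus)+

lemma coframe_br:
  assumes "k \<in> {1..5}"
  shows "coframe e k (br x y) =
      (coframe e 1 x * coframe e 2 y - coframe e 2 x * coframe e 1 y) * C 1 2 k
    + (coframe e 1 x * coframe e 3 y - coframe e 3 x * coframe e 1 y) * C 1 3 k
    + (coframe e 1 x * coframe e 4 y - coframe e 4 x * coframe e 1 y) * C 1 4 k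
    + (coframe e 1 x * coframe e 5 y - coframe e 5 x * coframe e 1 y) * C 1 5 k
    + (coframe e 2 x * coframe e 3 y - coframe e 3 x * coframe e 2 y) * C 2 3 k
    + (coframe e 2 x * coframe e 4 y - coframe e 4 x * coframe e 2 y) * C 2 4 k
    + (coframe e 2 x * coframe e 5 y - coframe e 5 x * coframe e 2 y) * C 2 5 k
    + (coframe e 3 x * coframe e 4 y - coframe e 4 x * coframe e 3 y) * C 3 4 k
    + (coframe e 3 x * coframe e 5 y - coframe e 5 x * coframe e 3 y) * C 3 5 k
    + (coframe e 4 x * coframe e 5 y - coframe e 5 x * coframe e 4 y) * C 4 5 k"
proof -
  have "br x y = br (coframe e 1 x *\<^sub>R e 1 + coframe e 2 x *\<^sub>R e 2 + coframe e 3 x *\<^sub>R e 3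
      + coframe e 4 x *\<^sub>R e 4 + coframe e 5 x *\<^sub>R e 5)
    (coframe e 1 y *\<^sub>R e 1 + coframe e 2 y *\<^sub>R e 2 + coframe e 3 y *\<^sub>R e 3
      + coframe e 4 y *\<^sub>R e 4 + coframe e 5 y *\<^sub>R e 5)"
    by (simp only: frame_expand[OF fr])
  then have "coframe e k (br x y) = g (br (coframe e 1 x *\<^sub>R e 1 + coframe e 2 x *\<^sub>R e 2
      + coframe e 3 x *\<^sub>R e 3
      + coframe e 4 x *\<^sub>R e 4 + coframe e 5 x *\<^sub>R e 5)
    (coframe e 1 y *\<^sub>R e 1 + coframe e 2 y *\<^sub>R e 2 + coframe e 3 y *\<^sub>R e 3
      + coframe e 4 y *\<^sub>R e 4 + coframe e 5 y *\<^sub>R e 5)) (e k)"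
    using frame_metric_basis[OF fr assms] by simp
  then show ?thesis
    by (simp add: bilinear_ladd[OF bilin(1)] bilinear_radd[OF bilin(1)] bilinear_lmul[OF bilin(1)]
      bilinear_rmul[OF bilin(1)] bilinear_ladd[OF bilin(2)] bilinear_lmul[OF bilin(2)] C_def[symmetric]
          C_same
      C_skew(1)[of 1 2] C_skew(1)[of 1 3] C_skew(1)[of 1 4] C_skew(1)[of 1 5] C_skew(1)[of 2 3]
          C_skew(1)[of 2 4]
      C_skew(1)[of 2 5] C_skew(1)[of 3 4] C_skew(1)[of 3 5] C_skew(1)[of 4 5]) (simp add: algebra_simps)
qed

text \<open>Up to the star this is the codifferential of the 3-form, the skew part in x, y of the
  symmetric contraction of \<open>C i j x * C i j y\<close> over \<open>i\<close>, \<open>j\<close>.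
  It is checked as a polynomial identity in the coordinates and the ten independent
  \<open>C\<close>.\<close>

lemma coclosed_3: "closed_form br 2 (hodge e 3 (form3 (\<lambda>x y z. g (br x y) z)))"
  unfolding closed_form_def
proof (intro allI impI)
  fix xs :: "'a list" assume "length xs = 2 + 1"
  then obtain x y z where xs: "xs = [x, y, z]" by
    (auto simp: length_Suc_conv numeral_eq_Suc One_nat_def)
  have k: "1 \<in> {1..5::nat}" "2 \<in> {1..5::nat}" "3 \<in> {1..5::nat}" "4 \<in> {1..5::nat}" "5 \<in> {1..5::nat}"
    by simp_all
  show "ext_deriv br (hodge e 3 (form3 (\<lambda>x y z. g (br x y) z))) xs = 0"
    unfolding xs ext_deriv_2 hodge_3[OF fr] C_def[symmetric] k[THEN coframe_br] C_sort C_same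
    by algebra
qed

end

section \<open>Assembling the theorem\<close>

lemma closed_form_uminus: "closed_form br k w \<Longrightarrow> closed_form br k (\<lambda>xs. - w xs)"
  by (simp add: closed_form_def ext_deriv_def sum_negf)

lemma hodge_uminus: "hodge e k (\<lambda>xs. - w xs) = (\<lambda>ys. - hodge e k w ys)"
  by (simp add: hodge_def Let_def sum_negf fun_eq_iff)

theorem theorem7p1:
  fixes br :: "'a::real_vector \<Rightarrow> 'a \<Rightarrow> 'a"
    and e :: "nat \<Rightarrow> 'a"
    and D :: "'a \<Rightarrow> 'a \<Rightarrow> 'a"
    and T :: "'a \<Rightarrow> 'a \<Rightarrow> 'a \<Rightarrow> real"
    and h p l1 l2 :: "'a set"
  assumes "lie_algebra br"
    and "frame e"
    and "nearly_integrable br e"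
    and "characteristic_connection br e D"
    and T_def: "T = torsion_form br e D"
    and h_def: "h = span {e 1, e 2, e 4}"
    and p_def: "p = span {e 3, e 5}"
    and "\<forall>x\<in>h. (\<forall>y\<in>h. D x y \<in> h) \<and> (\<forall>y\<in>p. D x y \<in> p)"
    and "\<forall>x\<in>p. (\<forall>y\<in>h. D x y \<in> p) \<and> (\<forall>y\<in>p. D x y \<in> h)"
    and "\<not> symmetric_pair br h p"
    and l1_def: "l1 = bracket_span br UNIV UNIV"
    and l2_def: "l2 = bracket_span br l1 l1"
  shows "(\<forall>i\<in>{1..5}. \<forall>j\<in>{1..5}. D (e i) (e j) = 0)
    \<and> harmonic_form br e 3 (form3 T)
    \<and> dim l1 = 3 \<and> l1 = l2"
proof -
  note fr = \<open>frame e\<close>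
  interpret characteristic br e D by (rule characteristic.intro) fact+
  have hp: "e i \<in> h" if "i \<in> {1, 2, 4}" for i using that by (auto simp: h_def intro: span_base)
  have pp: "e i \<in> p" if "i \<in> {3, 5}" for i using that by (auto simp: p_def intro: span_base)
  have h0: "coframe e 3 x = 0" "coframe e 5 x = 0" if "x \<in> h" for x
    using that coframe_span_zero[OF fr, of 3 x "{1, 2, 4}"] coframe_span_zero[OF fr, of 5 x "{1, 2, 4}"]
    by (auto simp: h_def)
  interpret adapted br e D
  proof unfold_locales
    fix i :: nat
    show "coframe e 3 (D (e i) (e 1)) = 0" "coframe e 5 (D (e i) (e 1)) = 0" if "i \<in> {1, 2, 4}"
      using assms(8) hp[OF that] hp[of 1] h0 by auto
    show "coframe e 5 (D (e i) (e 3)) = 0" if "i \<in> {3, 5}"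
      using assms(9) pp[OF that] pp[of 3] h0 by auto
  qed
  have sub: "subspace h" "subspace p" by (simp_all add: h_def p_def)
  have br_mem: "br (e i) (e j) \<in> S"
    if "D (e i) (e j) \<in> S" "D (e j) (e i) \<in> S" "\<And>k. k \<in> {1..5} \<Longrightarrow> \<tau> i j k \<noteq> 0 \<Longrightarrow> e k \<in> S" "subspace S"
        for i j S
  proof -
    have "\<tau> i j k *\<^sub>R e k \<in> S" if "k \<in> {1..5}" for k
      using that \<open>\<And>k. k \<in> {1..5} \<Longrightarrow> \<tau> i j k \<noteq> 0 \<Longrightarrow> e k \<in> S\<close>[OF that] \<open>subspace S\<close>
      by (cases "\<tau> i j k = 0") (auto simp: subspace_0 subspace_scale)
    then show ?thesis
      unfolding bracket_frame using that by (intro subspace_diff subspace_add) auto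
  qed
  \<comment> \<open>If no torsion component of type (h, h, p) survived, the stability of
    \<open>D\<close> would put every bracket where a symmetric pair requires it.\<close>
  have ne: "\<exists>i\<in>{1, 2, 4}. \<exists>j\<in>{1, 2, 4}. \<exists>k\<in>{3, 5}. \<tau> i j k \<noteq> 0"
  proof (rule ccontr)
    assume "\<not> ?thesis"
    then have z: "\<tau> i j k = 0" if "i \<in> {1, 2, 4}" "j \<in> {1, 2, 4}" "k \<in> {3, 5}" for i j k
      using that by blast
    have cases5: "k \<in> {1, 2, 4} \<or> k \<in> {3, 5}" if "k \<in> {1..5::nat}" for k
      using that by (auto simp: atLeastAtMost_1_5)
    have "br (e i) (e j) \<in> h" if i: "i \<in> {1, 2, 4}" and j: "j \<in> {1, 2, 4}" for i j
    proof (intro br_mem sub)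
      show "D (e i) (e j) \<in> h" "D (e j) (e i) \<in> h" using assms(8) hp[OF i] hp[OF j] by blast+
      show "e k \<in> h" if "k \<in> {1..5}" "\<tau> i j k \<noteq> 0" for k
        using that z[OF i j, of k] cases5[of k] hp[of k] by blast
    qed
    then have AB1: "br x y \<in> h" if "x \<in> {e 1, e 2, e 4}" "y \<in> {e 1, e 2, e 4}" for x y using that
        by auto
    have hh: "br x y \<in> h" if "x \<in> h" "y \<in> h" for x y
      by (rule bilinear_span_mem[OF bilin(2) sub(1) AB1]) (use that in \<open>simp_all only: h_def p_def\<close>)
    have "br (e i) (e j) \<in> p" if i: "i \<in> {1, 2, 4}" and j: "j \<in> {3, 5}" for i j
    proof (intro br_mem sub)
      show "D (e i) (e j) \<in> p" "D (e j) (e i) \<in> p" using assms(8,9) hp[OF i] pp[OF j] by blast+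
      \<comment> \<open>A component with \<open>k\<close> in {1, 2, 4} is of type (h, h, p) after
        exchanging the last two indices, hence zero.\<close>
      show "e k \<in> p" if "k \<in> {1..5}" "\<tau> i j k \<noteq> 0" for k
        using that z[OF i _ j, of k] tau_skew(2)[of i k j] cases5[OF that(1)] pp[of k]
            by (metis neg_equal_0_iff_equal)
    qed
    then have AB2: "br x y \<in> p" if "x \<in> {e 1, e 2, e 4}" "y \<in> {e 3, e 5}" for x y using that by auto
    have hpp: "br x y \<in> p" if "x \<in> h" "y \<in> p" for x y
      by (rule bilinear_span_mem[OF bilin(2) sub(2) AB2]) (use that in \<open>simp_all only: h_def p_def\<close>)
    have "br (e i) (e j) \<in> h" if i: "i \<in> {3, 5}" and j: "j \<in> {3, 5}" for i j
    proof (intro br_mem sub)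
      show "D (e i) (e j) \<in> h" "D (e j) (e i) \<in> h" using assms(9) pp[OF i] pp[OF j] by blast+
      \<comment> \<open>Three indices from {3, 5} must repeat, so skewness excludes a component
        along p.\<close>
      show "e k \<in> h" if "k \<in> {1..5}" "\<tau> i j k \<noteq> 0" for k
        using that(2) i j tau_same cases5[OF that(1)] hp[of k]
            by (elim disjE) (auto simp only: insert_iff empty_iff)
    qed
    then have AB3: "br x y \<in> h" if "x \<in> {e 3, e 5}" "y \<in> {e 3, e 5}" for x y using that by auto
    have "br x y \<in> h" if "x \<in> p" "y \<in> p" for x y
      by (rule bilinear_span_mem[OF bilin(2) sub(1) AB3]) (use that in \<open>simp_all only: h_def p_def\<close>)
    with hh hpp assms(10) show False by (simp add: symmetric_pair_def)
  qed
  have D0: "D (e i) (e j) = 0" if "i \<in> {1..5}" "j \<in> {1..5}" for i j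
    using connection_zero[OF ne that] .
  have D_zero: "D x y = 0" for x y
  proof -
    have "D x y \<in> {0}"
      by (rule bilinear_span_mem[OF bilin(1), of "{0}" "e ` {1..5}" "e ` {1..5}"])
        (use D0 fr in \<open>auto simp: frame_def\<close>)
    then show ?thesis by simp
  qed
  have T: "T = (\<lambda>x y z. - frame_metric e (br x y) z)"
    by (intro ext) (simp add: T_def torsion_form_def D_zero bilinear_lneg[OF frame_metric_bilinear[OF
        fr]])
  have "totally_skew T" using char by (simp add: T_def characteristic_connection_def)
  \<comment> \<open>As \<open>D\<close> vanishes, skewness of the torsion is exactly bi-invariance
    of the metric.\<close>
  then have "totally_skew (\<lambda>x y z. frame_metric e (br x y) z)"
    unfolding T totally_skew_def neg_equal_iff_equal .
  then interpret b: biinvariant br e using lie fr by (intro biinvariant.intro)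
  obtain i j k where "i \<in> {1, 2, 4}" "j \<in> {1, 2, 4}" "k \<in> {3, 5}" "\<tau> i j k \<noteq> 0"
    using ne by blast
  moreover have "\<tau> i j k = - b.C i j k"
    unfolding \<tau>_def b.C_def T_def[symmetric] T ..
  ultimately have ijk: "i \<in> {1..5}" "j \<in> {1..5}" "k \<in> {1..5}" "b.C i j k \<noteq> 0" by auto
  have "form3 T = (\<lambda>xs. - form3 (\<lambda>x y z. frame_metric e (br x y) z) xs)"
    by (simp add: T form3_def fun_eq_iff)
  then have "harmonic_form br e 3 (form3 T)"
    using b.closed_3 b.coclosed_3 by (simp add: harmonic_form_def hodge_uminus closed_form_uminus)
  then show ?thesis
    using D0 b.dim_commutator[OF ijk(4,1,2,3)] b.commutator_perfect[OF ijk(4,1,2,3)]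
    by (simp add: l1_def l2_def)
qed

end
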